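(* Let $K$ be a field which is not real closed. If $K$ is henselian with respect to a valuation with real closed residue field, then $K$ admits a non-trivial $\emptyset$-definable henselian valuation.
   Context: A valuation $v$ on $K$ is $\emptyset$-definable if there is a parameter-free first-order formula in the language of rings defining its valuation ring $\mathcal{O}_v$ in $K$. *)

theory Defs
  imports "HOL-Algebra.Algebraic_Closure_Type"
begin

section \<open>Real closed fields\<close>

text \<open>
  The field \<open>K\<close> of the theorem is a type of class \<^class>\<open>field\<close>, but its residue fields are
  quotient rings and hence records. Real closedness is therefore defined on records; for \<open>K\<close> itself
  it is applied to \<^const>\<open>ring_of_type_algebra\<close>, the record of all elements of the type.
\<close>

locale ordered_field = field R for R (structure) +
  fixes le :: "('a \<times> 'a) set"
  assumes le_linear: "linear_order_on (carrier R) le"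
    and le_add: "\<lbrakk>(x, y) \<in> le; z \<in> carrier R\<rbrakk> \<Longrightarrow> (x \<oplus> z, y \<oplus> z) \<in> le"
    and le_mult: "\<lbrakk>(\<zero>, x) \<in> le; (\<zero>, y) \<in> le\<rbrakk> \<Longrightarrow> (\<zero>, x \<otimes> y) \<in> le"

text \<open>
  Polynomials over a record are the coefficient lists of \<^const>\<open>univ_poly\<close>, leading coefficient
  first and non-zero.
\<close>

definition real_closed :: "('a, 'b) ring_scheme \<Rightarrow> bool" where
  "real_closed R \<longleftrightarrow>
     (\<exists>le. ordered_field R le \<and>
       (\<forall>x. (\<zero>\<^bsub>R\<^esub>, x) \<in> le \<longrightarrow> (\<exists>y\<in>carrier R. x = y \<otimes>\<^bsub>R\<^esub> y)) \<and>
       (\<forall>p\<in>carrier (poly_ring R).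
          odd (Polynomials.degree p) \<longrightarrow> (\<exists>x\<in>carrier R. ring.eval R p x = \<zero>\<^bsub>R\<^esub>)))"


section \<open>Valuations\<close>

text \<open>
  The value group is written multiplicatively, as everywhere in \<open>HOL-Algebra\<close>: its neutral element
  \<open>\<one>\<close> is the \<open>0\<close> of the usual additive notation. The order is not reversed, so the valuation ring
  consists of the elements of value \<open>\<ge> \<one>\<close>. The type \<open>'g\<close> carrying the group is arbitrary; when the
  existence of a valuation on \<open>'a\<close> is asserted it can be taken to be \<open>'a set\<close>, since the value group of
  a valuation with unit group \<open>U\<close> is the set of cosets of \<open>U\<close> in the multiplicative group.
\<close>

record 'g ordered_group = "'g monoid" +
  grp_le :: "('g \<times> 'g) set"

locale ordered_abelian_group = comm_group G for G :: "'g ordered_group" (structure) +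
  assumes grp_le_linear: "linear_order_on (carrier G) (grp_le G)"
    and grp_le_mult: "\<lbrakk>(x, y) \<in> grp_le G; z \<in> carrier G\<rbrakk> \<Longrightarrow> (x \<otimes> z, y \<otimes> z) \<in> grp_le G"

text \<open>
  The value \<open>\<infinity>\<close> of \<open>0\<close> is left implicit: \<open>v\<close> is only meaningful on non-zero elements, and \<open>0\<close> is
  added by hand to the valuation ring and to its maximal ideal.
\<close>

locale valuation = ordered_abelian_group G for G :: "'g ordered_group" (structure) +
  fixes v :: "'a::field \<Rightarrow> 'g"
  assumes v_onto: "v ` (UNIV - {0}) = carrier G"
    and v_mult: "\<lbrakk>x \<noteq> 0; y \<noteq> 0\<rbrakk> \<Longrightarrow> v (x * y) = v x \<otimes> v y"
    and v_add: "\<lbrakk>x \<noteq> 0; y \<noteq> 0; x + y \<noteq> 0\<rbrakk>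
      \<Longrightarrow> (v x, v (x + y)) \<in> grp_le G \<or> (v y, v (x + y)) \<in> grp_le G"

definition nontrivial_valuation :: "'g ordered_group \<Rightarrow> ('a::field \<Rightarrow> 'g) \<Rightarrow> bool" where
  "nontrivial_valuation G v \<longleftrightarrow> (\<exists>x. x \<noteq> 0 \<and> v x \<noteq> \<one>\<^bsub>G\<^esub>)"

definition valuation_ring :: "'g ordered_group \<Rightarrow> ('a::field \<Rightarrow> 'g) \<Rightarrow> 'a set" where
  "valuation_ring G v = {x. x = 0 \<or> (\<one>\<^bsub>G\<^esub>, v x) \<in> grp_le G}"

definition valuation_ideal :: "'g ordered_group \<Rightarrow> ('a::field \<Rightarrow> 'g) \<Rightarrow> 'a set" where
  "valuation_ideal G v = {x. x = 0 \<or> ((\<one>\<^bsub>G\<^esub>, v x) \<in> grp_le G \<and> v x \<noteq> \<one>\<^bsub>G\<^esub>)}"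

definition residue_field :: "'g ordered_group \<Rightarrow> ('a::field \<Rightarrow> 'g) \<Rightarrow> 'a set ring" where
  "residue_field G v =
     (ring_of_type_algebra\<lparr>carrier := valuation_ring G v\<rparr>) Quot (valuation_ideal G v)"

text \<open>Henselianity is Hensel's lemma for simple residue zeros.\<close>

definition henselian :: "'g ordered_group \<Rightarrow> ('a::field \<Rightarrow> 'g) \<Rightarrow> bool" where
  "henselian G v \<longleftrightarrow>
     (\<forall>f :: 'a poly. (\<forall>i. Polynomial.coeff f i \<in> valuation_ring G v) \<longrightarrow>
       (\<forall>a\<in>valuation_ring G v.
          poly f a \<in> valuation_ideal G v \<and> poly (Polynomial.pderiv f) a \<notin> valuation_ideal G v \<longrightarrow>
          (\<exists>b\<in>valuation_ring G v. poly f b = 0 \<and> b - a \<in> valuation_ideal G v)))"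


section \<open>First-order formulas in the language of rings\<close>

datatype ring_term =
    TVar nat | TZero | TOne | TNeg ring_term
  | TAdd ring_term ring_term | TMult ring_term ring_term

datatype ring_formula =
    FEq ring_term ring_term | FNot ring_formula
  | FAnd ring_formula ring_formula | FOr ring_formula ring_formula
  | FImp ring_formula ring_formula
  | FEx nat ring_formula | FAll nat ring_formula

primrec term_vars :: "ring_term \<Rightarrow> nat set" where
  "term_vars (TVar n) = {n}"
| "term_vars TZero = {}"
| "term_vars TOne = {}"
| "term_vars (TNeg s) = term_vars s"
| "term_vars (TAdd s t) = term_vars s \<union> term_vars t"
| "term_vars (TMult s t) = term_vars s \<union> term_vars t"

primrec free_vars :: "ring_formula \<Rightarrow> nat set" where
  "free_vars (FEq s t) = term_vars s \<union> term_vars t"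
| "free_vars (FNot \<phi>) = free_vars \<phi>"
| "free_vars (FAnd \<phi> \<psi>) = free_vars \<phi> \<union> free_vars \<psi>"
| "free_vars (FOr \<phi> \<psi>) = free_vars \<phi> \<union> free_vars \<psi>"
| "free_vars (FImp \<phi> \<psi>) = free_vars \<phi> \<union> free_vars \<psi>"
| "free_vars (FEx n \<phi>) = free_vars \<phi> - {n}"
| "free_vars (FAll n \<phi>) = free_vars \<phi> - {n}"

primrec term_val :: "(nat \<Rightarrow> 'a::comm_ring_1) \<Rightarrow> ring_term \<Rightarrow> 'a" where
  "term_val e (TVar n) = e n"
| "term_val e TZero = 0"
| "term_val e TOne = 1"
| "term_val e (TNeg s) = - term_val e s"
| "term_val e (TAdd s t) = term_val e s + term_val e t"
| "term_val e (TMult s t) = term_val e s * term_val e t"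

primrec sat :: "(nat \<Rightarrow> 'a::comm_ring_1) \<Rightarrow> ring_formula \<Rightarrow> bool" where
  "sat e (FEq s t) \<longleftrightarrow> term_val e s = term_val e t"
| "sat e (FNot \<phi>) \<longleftrightarrow> \<not> sat e \<phi>"
| "sat e (FAnd \<phi> \<psi>) \<longleftrightarrow> sat e \<phi> \<and> sat e \<psi>"
| "sat e (FOr \<phi> \<psi>) \<longleftrightarrow> sat e \<phi> \<or> sat e \<psi>"
| "sat e (FImp \<phi> \<psi>) \<longleftrightarrow> (sat e \<phi> \<longrightarrow> sat e \<psi>)"
| "sat e (FEx n \<phi>) \<longleftrightarrow> (\<exists>x. sat (e(n := x)) \<phi>)"
| "sat e (FAll n \<phi>) \<longleftrightarrow> (\<forall>x. sat (e(n := x)) \<phi>)"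

text \<open>
  \<open>\<phi>\<close> has no parameters and at most the free variable \<open>0\<close>; the value \<open>0\<close> that the assignment gives
  to all other variables is therefore irrelevant.
\<close>

definition zero_definable_set :: "'a::comm_ring_1 set \<Rightarrow> bool" where
  "zero_definable_set S \<longleftrightarrow>
     (\<exists>\<phi>. free_vars \<phi> \<subseteq> {0} \<and> S = {x. sat ((\<lambda>_. 0)(0 := x)) \<phi>})"

definition zero_definable_valuation :: "'g ordered_group \<Rightarrow> ('a::field \<Rightarrow> 'g) \<Rightarrow> bool" where
  "zero_definable_valuation G v \<longleftrightarrow> zero_definable_set (valuation_ring G v)"

end

theory Submission
  imports Defs
begin

text \<open>
  Let \<open>A\<close> be the valuation ring of \<open>v\<close> and \<open>\<Gamma>\<close> its value group, and let \<open>T\<close> be the group of all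
  \<open>\<plusminus> y^n\<close> with \<open>y \<noteq> 0\<close>. By Hensel's lemma and real closedness of the residue field, every unit of
  \<open>A\<close> lies in \<open>T\<close>, so \<open>T\<close> is the preimage of \<open>n\<Gamma>\<close>.

  If \<open>\<Gamma>\<close> is divisible, then \<open>K\<close> is real closed: the squares are a positive cone, and a polynomial of
  odd degree is treated by descent on the multiplicity of an odd-multiplicity residue zero. A
  Tschirnhaus shift followed by a rescaling, which uses divisibility, replaces the polynomial by one
  whose reduction has degree that multiplicity but is not a pure power, so it has an odd-multiplicity
  zero of smaller multiplicity; multiplicity one is Hensel's lemma.

  Otherwise \<open>n\<Gamma> \<noteq> \<Gamma>\<close> for some \<open>n\<close>. Coarsening \<open>v\<close> by the largest convex subgroup contained in
  \<open>n\<Gamma>\<close> gives a non-trivial henselian valuation. For \<open>y \<notin> T\<close> one has \<open>1 + y \<in> T\<close> iff \<open>v y > 0\<close>, which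
  makes the coarsened valuation ring definable from \<open>T\<close>.
\<close>

section \<open>Valuation subrings\<close>

text \<open>As \<open>inverse 0 = 0\<close>, the axiom \<open>total\<close> also yields
  \<open>0 \<in> A\<close>. The whole field is an instance, which is used later to treat
  \<open>K\<close> itself.\<close>

locale valuation_subring =
  fixes A :: "'a::field set"
  assumes one_mem: "1 \<in> A"
    and uminus_closed: "x \<in> A \<Longrightarrow> - x \<in> A"
    and add_closed: "\<lbrakk>x \<in> A; y \<in> A\<rbrakk> \<Longrightarrow> x + y \<in> A"
    and mult_closed: "\<lbrakk>x \<in> A; y \<in> A\<rbrakk> \<Longrightarrow> x * y \<in> A"
    and total: "x \<in> A \<or> inverse x \<in> A"
begin

text \<open>These are the non-units; zero needs its own clause because \<open>inverse 0 = 0\<close>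
  lies in \<open>A\<close>.\<close>

definition M :: "'a set" where
  "M = {x \<in> A. x = 0 \<or> inverse x \<notin> A}"

lemma zero_mem: "0 \<in> A"
  using total[of 0] by simp

lemma diff_closed: "\<lbrakk>x \<in> A; y \<in> A\<rbrakk> \<Longrightarrow> x - y \<in> A"
  using add_closed[of x "- y"] uminus_closed[of y] by simp

lemma power_closed: "x \<in> A \<Longrightarrow> x ^ n \<in> A"
  by (induction n) (auto intro: one_mem mult_closed)

lemma of_nat_closed: "of_nat n \<in> A"
  by (induction n) (auto intro: zero_mem one_mem add_closed)

lemma sum_closed: "(\<And>i. i \<in> I \<Longrightarrow> f i \<in> A) \<Longrightarrow> sum f I \<in> A"
  by (induction I rule: infinite_finite_induct) (auto intro: zero_mem add_closed)

lemma M_subset: "x \<in> M \<Longrightarrow> x \<in> A"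
  by (simp add: M_def)

lemma zero_in_M: "0 \<in> M"
  by (simp add: M_def zero_mem)

lemma one_notin_M: "1 \<notin> M"
  by (simp add: M_def one_mem)

lemma unit_inverse: "\<lbrakk>x \<in> A; x \<notin> M\<rbrakk> \<Longrightarrow> x \<noteq> 0 \<and> inverse x \<in> A \<and> inverse x \<notin> M"
  by (auto simp: M_def)

lemma notin_imp_inverse_in_M: "x \<notin> A \<Longrightarrow> inverse x \<in> M"
  using total[of x] by (auto simp: M_def)

lemma M_mult: assumes "x \<in> M" "y \<in> A" shows "x * y \<in> M"
proof (cases "x * y = 0")
  case False
  have "inverse (x * y) \<notin> A"
  proof
    assume "inverse (x * y) \<in> A"
    then have "y * inverse (x * y) \<in> A"
      by (rule mult_closed[OF assms(2)])
    moreover have "y * inverse (x * y) = inverse x"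
      using False by (simp add: field_simps)
    ultimately have "inverse x \<in> A"
      by (simp only:)
    then show False
      using assms False by (auto simp: M_def)
  qed
  then show ?thesis
    using assms mult_closed by (auto simp: M_def)
qed (auto simp: zero_in_M)

lemma M_mult': "\<lbrakk>x \<in> A; y \<in> M\<rbrakk> \<Longrightarrow> x * y \<in> M"
  using M_mult[of y x] by (simp add: mult.commute)

lemma M_uminus: "x \<in> M \<Longrightarrow> - x \<in> M"
  using M_mult[of x "- 1"] uminus_closed one_mem by simp

text \<open>Factoring out the summand of smaller value, \<open>a + b = a * (1 + b / a)\<close>,
  reduces the claim to \<open>M_mult\<close>.\<close>

lemma M_add: assumes "x \<in> M" "y \<in> M" shows "x + y \<in> M"
proof -
  have *: "a + b \<in> M" if "a \<in> M" "b \<in> M" "b / a \<in> A" "a \<noteq> 0" for a b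
  proof -
    have "a + b = a * (1 + b / a)"
      using that by (simp add: field_simps)
    moreover have "a * (1 + b / a) \<in> M"
      by (intro M_mult add_closed one_mem that)
    ultimately show ?thesis
      by (simp only:)
  qed
  show ?thesis
  proof (cases "x = 0 \<or> y = 0")
    case False
    then have "y / x \<in> A \<or> x / y \<in> A"
      using total[of "y / x"] by simp
    then show ?thesis
      using *[of x y] *[of y x] assms False by (metis add.commute)
  qed (use assms in auto)
qed

lemma M_diff: "\<lbrakk>x \<in> M; y \<in> M\<rbrakk> \<Longrightarrow> x - y \<in> M"
  using M_add[of x "- y"] M_uminus[of y] by simp

lemma M_sum: "(\<And>i. i \<in> I \<Longrightarrow> f i \<in> M) \<Longrightarrow> sum f I \<in> M"
  by (induction I rule: infinite_finite_induct) (auto intro: zero_in_M M_add)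

lemma M_prime: assumes "x \<in> A" "y \<in> A" "x * y \<in> M" shows "x \<in> M \<or> y \<in> M"
proof (rule ccontr)
  assume "\<not> ?thesis"
  then have "x \<noteq> 0" "inverse x \<in> A" "y \<notin> M"
    using unit_inverse assms by blast+
  moreover have "inverse x * (x * y) = y"
    using \<open>x \<noteq> 0\<close> by simp
  ultimately show False
    using M_mult'[of "inverse x" "x * y"] assms by metis
qed

lemma M_mult_iff: "\<lbrakk>x \<in> A; y \<in> A\<rbrakk> \<Longrightarrow> x * y \<in> M \<longleftrightarrow> x \<in> M \<or> y \<in> M"
  using M_prime M_mult M_mult' by blast

lemma M_power: "\<lbrakk>x \<in> A; x ^ n \<in> M\<rbrakk> \<Longrightarrow> x \<in> M"
  by (induction n) (auto simp: one_notin_M M_mult_iff power_closed)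

lemma M_cong: "\<lbrakk>x - y \<in> M\<rbrakk> \<Longrightarrow> x \<in> M \<longleftrightarrow> y \<in> M"
  using M_diff[of x "x - y"] M_add[of "x - y" y] by auto

lemma one_add_M: "x \<in> M \<Longrightarrow> 1 + x \<in> A \<and> 1 + x \<notin> M"
  using M_cong[of "1 + x" 1] one_notin_M add_closed one_mem M_subset by auto

text \<open>Outside \<open>A\<close> the inverse of \<open>x\<close> lies in \<open>M\<close>, hence
  so does the inverse of \<open>x ^ n\<close>.\<close>

lemma A_powerD: assumes "x ^ n \<in> A" "n > 0" shows "x \<in> A"
proof (rule ccontr)
  assume x: "x \<notin> A"
  obtain k where "n = Suc k"
    using assms(2) gr0_implies_Suc by blast
  then have "inverse x ^ n \<in> M"
    using notin_imp_inverse_in_M[OF x] by (simp add: M_mult M_subset power_closed)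
  then have "inverse (x ^ n) \<in> M"
    by (simp add: power_inverse)
  then show False
    using assms x zero_mem by (auto simp: M_def)
qed

text \<open>In terms of the valuation, \<open>c\<close> is an element of least value in
  \<open>D\<close>.\<close>

lemma exists_minimal:
  assumes "finite D" "D \<noteq> {}" "0 \<notin> D"
  shows "\<exists>c\<in>D. \<forall>d\<in>D. d / c \<in> A"
  using assms
proof (induction D rule: finite_ne_induct)
  case (singleton x)
  then show ?case by (simp add: one_mem)
next
  case (insert x F)
  then obtain c where c: "c \<in> F" "\<forall>d\<in>F. d / c \<in> A" by auto
  show ?case
  proof (cases "x / c \<in> A")
    case True
    then show ?thesis using c by auto
  next
    case False
    then have "c / x \<in> A"
      using total[of "x / c"] by simp
    moreover have "c \<noteq> 0"
      using c insert.prems by auto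
    ultimately have "d / x \<in> A" if "d \<in> F" for d
      using mult_closed[of "d / c" "c / x"] c that by auto
    then show ?thesis
      using c insert.prems one_mem by (intro bexI[of _ x]) auto
  qed
qed

section \<open>Polynomials over the valuation ring and over its maximal ideal\<close>

definition PA :: "'a poly set" where
  "PA = {p. \<forall>i. Polynomial.coeff p i \<in> A}"

definition PM :: "'a poly set" where
  "PM = {p. \<forall>i. Polynomial.coeff p i \<in> M}"

lemma PA_pCons [simp]: "pCons a p \<in> PA \<longleftrightarrow> a \<in> A \<and> p \<in> PA"
  by (auto simp: PA_def coeff_pCons split: nat.splits)

lemma PM_pCons [simp]: "pCons a p \<in> PM \<longleftrightarrow> a \<in> M \<and> p \<in> PM"
  by (auto simp: PM_def coeff_pCons split: nat.splits)

lemma PA_0 [simp]: "0 \<in> PA" and PM_0 [simp]: "0 \<in> PM"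
  by (simp_all add: PA_def PM_def zero_mem zero_in_M)

lemma PA_1: "1 \<in> PA"
  by (simp add: one_pCons one_mem)

lemma PM_subset: "p \<in> PM \<Longrightarrow> p \<in> PA"
  by (auto simp: PA_def PM_def M_subset)

lemma PA_add: "\<lbrakk>p \<in> PA; q \<in> PA\<rbrakk> \<Longrightarrow> p + q \<in> PA"
  and PM_add: "\<lbrakk>p \<in> PM; q \<in> PM\<rbrakk> \<Longrightarrow> p + q \<in> PM"
  by (simp_all add: PA_def PM_def add_closed M_add)

lemma PA_diff: "\<lbrakk>p \<in> PA; q \<in> PA\<rbrakk> \<Longrightarrow> p - q \<in> PA"
  by (simp add: PA_def diff_closed)

lemma PA_mult: "\<lbrakk>p \<in> PA; q \<in> PA\<rbrakk> \<Longrightarrow> p * q \<in> PA"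
  by (simp add: PA_def Polynomial.coeff_mult sum_closed mult_closed)

lemma PM_mult: "\<lbrakk>p \<in> PA; q \<in> PM\<rbrakk> \<Longrightarrow> p * q \<in> PM"
  by (simp add: PA_def PM_def Polynomial.coeff_mult M_sum M_mult')

lemma PM_smult: "\<lbrakk>c \<in> M; q \<in> PA\<rbrakk> \<Longrightarrow> Polynomial.smult c q \<in> PM"
  by (simp add: PA_def PM_def M_mult)

lemma PA_power: "p \<in> PA \<Longrightarrow> p ^ n \<in> PA"
  by (induction n) (auto intro: PA_mult PA_1)

lemma PA_poly: "\<lbrakk>p \<in> PA; a \<in> A\<rbrakk> \<Longrightarrow> poly p a \<in> A"
  by (induction p) (auto intro: add_closed mult_closed zero_mem)

lemma PM_poly: "\<lbrakk>p \<in> PM; a \<in> A\<rbrakk> \<Longrightarrow> poly p a \<in> M"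
  by (induction p) (auto intro: M_add M_mult' zero_in_M)

lemma PA_monom: "c \<in> A \<Longrightarrow> Polynomial.monom c n \<in> PA"
  by (simp add: PA_def zero_mem)

lemma PA_pcompose: "\<lbrakk>p \<in> PA; q \<in> PA\<rbrakk> \<Longrightarrow> pcompose p q \<in> PA"
  by (induction p) (auto simp: pcompose_pCons intro!: PA_add PA_mult)

lemma PM_pcompose: "\<lbrakk>p \<in> PM; q \<in> PA\<rbrakk> \<Longrightarrow> pcompose p q \<in> PM"
  by (induction p) (auto simp: pcompose_pCons intro!: PM_add PM_mult)

lemma PA_higher_pderiv: "p \<in> PA \<Longrightarrow> (pderiv ^^ n) p \<in> PA"
proof (induction n)
  case (Suc n)
  then show ?case
    by (auto simp: PA_def coeff_pderiv intro!: mult_closed of_nat_closed simp del: of_nat_Suc)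
qed simp

lemma PA_synthetic_div: "\<lbrakk>p \<in> PA; a \<in> A\<rbrakk> \<Longrightarrow> synthetic_div p a \<in> PA"
  by (induction p) (auto intro: PA_poly)

lemma poly_cong:
  assumes "p \<in> PA" "a \<in> A" "b \<in> A" "a - b \<in> M"
  shows "poly p a - poly p b \<in> M"
  using assms(1)
proof (induction p)
  case (pCons c p)
  have "poly (pCons c p) a - poly (pCons c p) b = (a - b) * poly p a + b * (poly p a - poly p b)"
    by (simp add: algebra_simps)
  then show ?case
    using pCons assms by (auto intro!: M_add M_mult[of "a - b"] M_mult'[of b] PA_poly)
qed (simp add: zero_in_M)

lemma shift_cong:
  assumes "p \<in> PA" "e \<in> M"
  shows "pcompose p [:e, 1:] - p \<in> PM"
  using assms(1)
proof (induction p)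
  case (pCons c p)
  have "pcompose (pCons c p) [:e, 1:] - pCons c p
      = pCons 0 (pcompose p [:e, 1:] - p) + Polynomial.smult e (pcompose p [:e, 1:])"
    by (simp add: pcompose_pCons)
  moreover have "pcompose p [:e, 1:] \<in> PA"
    using pCons assms M_subset one_mem by (auto intro!: PA_pcompose)
  ultimately show ?case
    using pCons assms by (auto intro!: PM_add PM_smult simp: zero_in_M)
qed simp

end

section \<open>Hensel's lemma and coarsenings\<close>

locale henselian_subring = valuation_subring +
  assumes hensel: "\<lbrakk>p \<in> PA; a \<in> A; poly p a \<in> M; poly (pderiv p) a \<notin> M\<rbrakk>
    \<Longrightarrow> \<exists>b\<in>A. poly p b = 0 \<and> b - a \<in> M"
begin

text \<open>A Hensel problem over \<open>B\<close> is moved to the residue zero \<open>0\<close> and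
  rescaled until it becomes one over \<open>A\<close> with the simple residue zero
  \<open>- 1\<close>.\<close>

lemma henselian_overring:
  assumes "valuation_subring B" "A \<subseteq> B"
  shows "henselian_subring B"
proof -
  interpret B: valuation_subring B by fact
  \<comment> \<open>The larger ring has the smaller maximal ideal: a non-zero \<open>x\<close> in
    \<open>B.M\<close> has its inverse outside \<open>B\<close>, hence outside
    \<open>A\<close>.\<close>
  have M_le: "x \<in> M" if "x \<in> B.M" for x
    using that assms(2) notin_imp_inverse_in_M[of "inverse x"] total[of x]
    by (auto simp: B.M_def M_def zero_mem)
  show ?thesis
  proof
    fix p a
    assume p: "p \<in> B.PA" and a: "a \<in> B" and pa: "poly p a \<in> B.M" and p'a: "poly (pderiv p) a \<notin> B.M"
    define q where "q = pcompose p [:a, 1:]"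
    have qB: "q \<in> B.PA"
      unfolding q_def using p a B.one_mem by (intro B.PA_pcompose) auto
    define c0 where "c0 = Polynomial.coeff q 0"
    define c1 where "c1 = Polynomial.coeff q 1"
    have c0: "c0 \<in> B.M"
      using pa by (simp add: c0_def q_def)
    have "c1 = poly (pderiv q) 0"
      by (simp add: c1_def poly_0_coeff_0 coeff_pderiv)
    also have "\<dots> = poly (pderiv p) a"
      by (simp add: q_def pderiv_pcompose poly_pcompose pderiv_pCons)
    finally have "c1 \<notin> B.M" using p'a by simp
    moreover have "c1 \<in> B"
      using qB by (auto simp: c1_def B.PA_def)
    ultimately have c1: "c1 \<noteq> 0" "inverse c1 \<in> B"
      using B.unit_inverse by auto
    define t where "t = c0 / c1"
    have t: "t \<in> B.M"
      unfolding t_def divide_inverse using c0 c1 by (intro B.M_mult)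
    show "\<exists>b\<in>B. poly p b = 0 \<and> b - a \<in> B.M"
    proof (cases "c0 = 0")
      case True
      then show ?thesis
        using a B.zero_in_M by (intro bexI[of _ a]) (auto simp: c0_def q_def)
    next
      case False
      \<comment> \<open>The choice \<open>t = c0 / c1\<close> makes the two lowest coefficients of
        \<open>g\<close> equal to 1. Each higher one keeps a factor \<open>t\<close> from
        \<open>B.M\<close>, so \<open>g\<close> is congruent to \<open>1 + X\<close> modulo
        \<open>M\<close>.\<close>
      define g where "g = Polynomial.smult (1 / c0) (pcompose q [:0, t:])"
      have cg: "Polynomial.coeff g i = Polynomial.coeff q i * t ^ i / c0" for i
        by (simp add: g_def coeff_pcompose_linear)
      have g0: "Polynomial.coeff g 0 = 1" and g1: "Polynomial.coeff g 1 = 1"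
        using False c1 by (simp_all add: cg t_def flip: c0_def c1_def One_nat_def)
      have g2: "Polynomial.coeff g (Suc (Suc i)) \<in> B.M" for i
      proof -
        have "Polynomial.coeff g (Suc (Suc i))
          = (Polynomial.coeff q (Suc (Suc i)) * t ^ i * inverse c1) * t"
          using False c1 by (simp add: cg t_def field_simps)
        moreover have "Polynomial.coeff q (Suc (Suc i)) * t ^ i * inverse c1 \<in> B"
          using qB t c1 by (intro B.mult_closed B.power_closed) (auto simp: B.PA_def B.M_subset)
        ultimately show ?thesis
          using B.M_mult'[OF _ t] by simp
      qed
      define r where "r = g - [:1, 1:]"
      have r: "r \<in> PM"
        unfolding PM_def mem_Collect_eq
      proof
        fix i
        show "Polynomial.coeff r i \<in> M"
        proof (cases i)
          case 0
          then show ?thesis using g0 by (simp add: r_def zero_in_M)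
        next
          case (Suc j)
          then show ?thesis
            using g1 M_le[OF g2] by (cases j) (simp_all add: r_def zero_in_M)
        qed
      qed
      have g_eq: "g = [:1, 1:] + r"
        by (simp add: r_def)
      have "- 1 \<in> A"
        by (intro uminus_closed one_mem)
      moreover have "g \<in> PA"
        unfolding g_eq using PM_subset[OF r] by (intro PA_add) (auto simp: one_mem)
      moreover have "poly g (- 1) \<in> M"
        unfolding g_eq using r \<open>- 1 \<in> A\<close> by (simp add: PM_poly)
      moreover have "pderiv r \<in> PM"
        using r by (auto simp: PM_def coeff_pderiv simp del: of_nat_Suc intro!: M_mult' of_nat_closed)
      then have "poly (pderiv g) (- 1) \<notin> M"
        unfolding g_eq using \<open>- 1 \<in> A\<close>
        by (simp add: pderiv_add pderiv_pCons PM_poly one_add_M)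
      ultimately obtain z where z: "z \<in> A" "poly g z = 0"
        using hensel by blast
      have "poly p (a + t * z) = 0"
        using z False by (simp add: g_def q_def poly_pcompose mult.commute)
      moreover have "t * z \<in> B.M"
        using t z assms(2) by (auto intro!: B.M_mult)
      ultimately show ?thesis
        using a by (intro bexI[of _ "a + t * z"]) (auto intro: B.add_closed B.M_subset)
    qed
  qed
qed

end

section \<open>Polynomials of odd degree\<close>

text \<open>These consequences of a real closed residue field are stated as congruences modulo
  \<open>M\<close>, so that the polynomial arguments never leave \<open>K\<close>.\<close>

locale real_closed_residue = henselian_subring +
  assumes residue_squares: "x \<in> A \<Longrightarrow> \<exists>y\<in>A. x - y * y \<in> M \<or> x + y * y \<in> M"
    and residue_sum_squares: "\<lbrakk>x \<in> A; y \<in> A\<rbrakk> \<Longrightarrow> 1 + x * x + y * y \<notin> M"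
    and residue_char_0: "of_nat (Suc n) \<notin> M"
    and residue_odd_degree: "\<lbrakk>p \<in> PA; lead_coeff p = 1; odd (Polynomial.degree p)\<rbrakk>
      \<Longrightarrow> \<exists>a\<in>A. poly p a \<in> M"
begin

lemma residue_fact: "of_nat (fact n) \<notin> M"
proof (induction n)
  case (Suc n)
  have "of_nat (Suc n) * of_nat (fact n) \<notin> M"
    using Suc residue_char_0[of n] M_mult_iff[OF of_nat_closed of_nat_closed] by blast
  then show ?case by (metis fact_Suc of_nat_id of_nat_mult)
qed (simp add: one_notin_M)

text \<open>Synthetic division by \<open>X - a\<close> is repeated while the value at
  \<open>a\<close> lies in \<open>M\<close>. That value is the remainder, so it vanishes modulo
  \<open>M\<close>.\<close>

lemma residue_factor_root:
  assumes "p \<in> PA" "lead_coeff p = 1" "a \<in> A"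
  shows "\<exists>r g. g \<in> PA \<and> lead_coeff g = 1 \<and> Polynomial.degree g + r = Polynomial.degree p \<and>
    p - [:- a, 1:] ^ r * g \<in> PM \<and> poly g a \<notin> M"
  using assms(1,2)
proof (induction "Polynomial.degree p" arbitrary: p rule: less_induct)
  case less
  show ?case
  proof (cases "poly p a \<in> M")
    case False
    then show ?thesis
      using less.prems by (intro exI[of _ 0] exI[of _ p]) auto
  next
    case True
    define q where "q = synthetic_div p a"
    have p_eq: "p = [:- a, 1:] * q + [:poly p a:]"
      unfolding q_def by (rule synthetic_div_correct'[symmetric])
    have deg: "Polynomial.degree p \<noteq> 0"
    proof
      assume "Polynomial.degree p = 0"
      then have "p = 1"
        using less.prems(2) by (auto elim!: degree_eq_zeroE simp: one_pCons)
      then show False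
        using True one_notin_M by simp
    qed
    have dq: "Suc (Polynomial.degree q) = Polynomial.degree p"
      using deg by (simp add: q_def degree_synthetic_div)
    have "Polynomial.coeff q (Polynomial.degree p - 1) = 1"
    proof -
      have "Polynomial.coeff p (Suc (Polynomial.degree q))
          = Polynomial.coeff q (Polynomial.degree q) - a * Polynomial.coeff q (Suc (Polynomial.degree q))"
        by (subst p_eq) (simp add: coeff_pCons)
      then show ?thesis
        using less.prems(2) by (simp add: coeff_eq_0 flip: dq)
    qed
    then have "lead_coeff q = 1"
      by (simp flip: dq)
    moreover have "q \<in> PA"
      unfolding q_def using less.prems assms by (intro PA_synthetic_div)
    ultimately obtain r g where rg: "g \<in> PA" "lead_coeff g = 1"
      "Polynomial.degree g + r = Polynomial.degree q" "q - [:- a, 1:] ^ r * g \<in> PM" "poly g a \<notin> M"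
      using less.hyps[of q] dq by auto
    have "p - [:- a, 1:] ^ Suc r * g = [:- a, 1:] * (q - [:- a, 1:] ^ r * g) + [:poly p a:]"
      by (subst p_eq) (simp only: algebra_simps power_Suc)
    also have "\<dots> \<in> PM"
      using rg(4) True uminus_closed[OF assms(3)] one_mem by (intro PM_add PM_mult) simp_all
    finally show ?thesis
      using rg dq by (intro exI[of _ "Suc r"] exI[of _ g]) auto
  qed
qed

text \<open>If the residue zero \<open>a\<close> has even multiplicity, the cofactor
  \<open>g\<close> still has odd degree, and induction finds an odd-multiplicity zero of
  \<open>g\<close>.\<close>

lemma residue_odd_multiplicity:
  assumes "p \<in> PA" "lead_coeff p = 1" "odd (Polynomial.degree p)"
  shows "\<exists>a\<in>A. \<exists>m g. odd m \<and> g \<in> PA \<and> p - [:- a, 1:] ^ m * g \<in> PM \<and> poly g a \<notin> M"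
  using assms
proof (induction "Polynomial.degree p" arbitrary: p rule: less_induct)
  case less
  obtain a where a: "a \<in> A" "poly p a \<in> M"
    using residue_odd_degree less.prems by blast
  obtain r g where g: "g \<in> PA" "lead_coeff g = 1" "Polynomial.degree g + r = Polynomial.degree p"
    "p - [:- a, 1:] ^ r * g \<in> PM" "poly g a \<notin> M"
    using residue_factor_root less.prems a by blast
  show ?case
  proof (cases "odd r")
    case True
    then show ?thesis
      using a g by (intro bexI[of _ a] exI[of _ r] exI[of _ g]) auto
  next
    case False
    have "r \<noteq> 0"
    proof
      assume "r = 0"
      then have "poly p a - poly g a \<in> M"
        using PM_poly[OF g(4) a(1)] by simp
      then show False
        using M_cong[of "poly p a" "poly g a"] a g by metis
    qed
    then obtain b m h where h: "b \<in> A" "odd m" "h \<in> PA" "g - [:- b, 1:] ^ m * h \<in> PM" "poly h b \<notin> M"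
      using less.hyps[of g] g less.prems False by (metis even_add less_add_same_cancel1 neq0_conv)
    have "poly g b \<in> M"
      using PM_poly[OF h(4,1)] odd_pos[OF h(2)] by (simp add: power_0_left)
    \<comment> \<open>Modulo \<open>M\<close>, \<open>g\<close> vanishes at \<open>b\<close> but not
      at \<open>a\<close>. Hence \<open>(b - a) ^ r\<close> is a unit, and restoring the factor
      \<open>(X - a) ^ r\<close> does not change the multiplicity at \<open>b\<close>.\<close>
    then have ab: "b - a \<notin> M"
      using poly_cong[OF g(1) h(1) a(1)] M_cong[of "poly g b" "poly g a"] g(5) by metis
    have lin: "[:- a, 1:] ^ r \<in> PA" "[:- b, 1:] ^ m \<in> PA"
      using uminus_closed[OF a(1)] uminus_closed[OF h(1)] one_mem by (simp_all add: PA_power)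
    have "p - [:- b, 1:] ^ m * ([:- a, 1:] ^ r * h)
      = (p - [:- a, 1:] ^ r * g) + [:- a, 1:] ^ r * (g - [:- b, 1:] ^ m * h)"
      by (simp only: algebra_simps)
    also have "\<dots> \<in> PM"
      using g h lin by (intro PM_add PM_mult)
    finally have "p - [:- b, 1:] ^ m * ([:- a, 1:] ^ r * h) \<in> PM" .
    moreover have "poly ([:- a, 1:] ^ r * h) b \<notin> M"
      using ab h a M_power[of "b - a" r]
      by (auto simp: M_mult_iff power_closed diff_closed PA_poly)
    moreover have "[:- a, 1:] ^ r * h \<in> PA"
      using h lin by (intro PA_mult)
    ultimately show ?thesis
      using h by (intro bexI[of _ b] exI[of _ m] exI[of _ "[:- a, 1:] ^ r * h"]) auto
  qed
qed

end

text \<open>This coefficient later shows that a pure power with vanishing second coefficient is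
  centred at zero.\<close>

lemma coeff_linear_power_minus_1:
  "Polynomial.coeff ([:a :: 'a::comm_semiring_1, 1:] ^ Suc n) n = of_nat (Suc n) * a"
  by (subst coeff_linear_poly_power) (simp_all add: Suc_diff_le del: of_nat_Suc binomial_Suc_Suc)

context real_closed_residue
begin

text \<open>This is the multiplicity of \<open>a\<close> as a zero of the reduction of
  \<open>p\<close>, read off the Taylor expansion at \<open>a\<close> and hence available without a
  factorization.\<close>

definition residue_multiplicity :: "'a poly \<Rightarrow> 'a \<Rightarrow> nat \<Rightarrow> bool" where
  "residue_multiplicity p a m \<longleftrightarrow>
     (\<forall>i<m. Polynomial.coeff (pcompose p [:a, 1:]) i \<in> M) \<and>
     Polynomial.coeff (pcompose p [:a, 1:]) m \<notin> M"

lemma shift_closed: "\<lbrakk>p \<in> PA; a \<in> A\<rbrakk> \<Longrightarrow> pcompose p [:a, 1:] \<in> PA"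
  by (intro PA_pcompose) (simp_all add: one_mem)

lemma shift_shift: "pcompose (pcompose (p :: 'a poly) [:a, 1:]) [:b, 1:] = pcompose p [:a + b, 1:]"
  by (subst pcompose_assoc[symmetric]) (simp add: pcompose_pCons)

lemma residue_multiplicity_cong:
  assumes "p - q \<in> PM" "a \<in> A"
  shows "residue_multiplicity p a m \<longleftrightarrow> residue_multiplicity q a m"
proof -
  have "pcompose (p - q) [:a, 1:] \<in> PM"
    using assms by (intro PM_pcompose) (simp_all add: one_mem)
  then have "Polynomial.coeff (pcompose p [:a, 1:]) i \<in> M \<longleftrightarrow> Polynomial.coeff (pcompose q [:a, 1:]) i \<in> M" for i
    by (intro M_cong) (simp add: PM_def pcompose_diff)
  then show ?thesis
    by (simp add: residue_multiplicity_def)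
qed

lemma residue_multiplicity_shift:
  assumes "residue_multiplicity p a m" "p \<in> PA" "a \<in> A" "b \<in> A" "b - a \<in> M"
  shows "residue_multiplicity p b m"
proof -
  have "pcompose (pcompose p [:a, 1:]) [:b - a, 1:] - pcompose p [:a, 1:] \<in> PM"
    using assms by (intro shift_cong shift_closed)
  then have "Polynomial.coeff (pcompose p [:b, 1:]) i \<in> M \<longleftrightarrow> Polynomial.coeff (pcompose p [:a, 1:]) i \<in> M" for i
    by (intro M_cong) (simp add: PM_def shift_shift)
  then show ?thesis
    using assms(1) by (simp add: residue_multiplicity_def)
qed

lemma residue_multiplicity_smult:
  assumes "residue_multiplicity p a m" "p \<in> PA" "a \<in> A" "c \<in> A" "c \<notin> M"
  shows "residue_multiplicity (Polynomial.smult c p) a m"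
proof -
  have "Polynomial.coeff (pcompose p [:a, 1:]) i \<in> A" for i
    using shift_closed assms by (auto simp: PA_def)
  then show ?thesis
    using assms by (simp add: residue_multiplicity_def pcompose_smult M_mult_iff)
qed

lemma residue_multiplicity_factor:
  assumes "g \<in> PA" "poly g a \<notin> M" "a \<in> A"
  shows "residue_multiplicity ([:- a, 1:] ^ m * g) a m"
proof -
  have "pcompose [:- a, 1:] [:a, 1:] = [:0, 1:]"
    by (simp add: pcompose_pCons)
  then have "pcompose ([:- a, 1:] ^ m) [:a, 1:] = Polynomial.monom 1 m"
    by (induction m)
      (simp_all add: pcompose_mult pcompose_1 monom_Suc monom_0 flip: one_pCons del: mult_pCons_left,
       simp)
  then have "pcompose ([:- a, 1:] ^ m * g) [:a, 1:] = Polynomial.monom 1 m * pcompose g [:a, 1:]"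
    by (simp add: pcompose_mult)
  then show ?thesis
    using assms by (simp add: residue_multiplicity_def coeff_monom_mult zero_in_M)
qed

text \<open>Taylor's formula: differentiation commutes with the shift, and the value at
  \<open>0\<close> is the constant coefficient.\<close>

lemma poly_higher_pderiv:
  "poly ((pderiv ^^ n) (p :: 'a poly)) a = of_nat (fact n) * Polynomial.coeff (pcompose p [:a, 1:]) n"
proof -
  have "pcompose ((pderiv ^^ n) p) [:a, 1:] = (pderiv ^^ n) (pcompose p [:a, 1:])"
  proof (induction n)
    case (Suc n)
    have "pcompose (pderiv q) [:a, 1:] = pderiv (pcompose q [:a, 1:])" for q :: "'a poly"
      by (simp add: pderiv_pcompose pderiv_pCons)
    then show ?case
      using Suc by simp
  qed simp
  then have "Polynomial.coeff (pcompose ((pderiv ^^ n) p) [:a, 1:]) 0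
    = pochhammer (of_nat (Suc 0)) n * Polynomial.coeff (pcompose p [:a, 1:]) n"
    by (simp add: coeff_higher_pderiv)
  moreover have "pochhammer (of_nat (Suc 0)) n = (of_nat (fact n) :: 'a)"
    unfolding pochhammer_of_nat by (simp add: pochhammer_fact)
  ultimately show ?thesis
    by simp
qed

text \<open>
  Tschirnhaus transformation of the residue factor of multiplicity \<open>m\<close>, without factoring \<open>p\<close>: the
  approximate root \<open>a\<close> is a simple residue zero of the derivative of order \<open>m - 1\<close>.
\<close>

lemma tschirnhaus:
  assumes "p \<in> PA" "a \<in> A" "residue_multiplicity p a m" "m > 0"
  shows "\<exists>b\<in>A. residue_multiplicity p b m \<and> Polynomial.coeff (pcompose p [:b, 1:]) (m - 1) = 0"
proof -
  define f where "f = (pderiv ^^ (m - 1)) p"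
  have cA: "Polynomial.coeff (pcompose p [:a, 1:]) i \<in> A" for i
    using shift_closed[OF assms(1,2)] by (simp add: PA_def)
  have "f \<in> PA"
    unfolding f_def using assms by (intro PA_higher_pderiv)
  moreover have "poly f a \<in> M"
    using assms by (simp add: f_def poly_higher_pderiv residue_multiplicity_def M_mult' of_nat_closed
        del: of_nat_fact)
  moreover have "pderiv f = (pderiv ^^ m) p"
    using assms(4) by (cases m) (simp_all add: f_def)
  then have "poly (pderiv f) a \<notin> M"
    using assms(3) residue_fact[of m] cA
    by (simp add: poly_higher_pderiv residue_multiplicity_def M_mult_iff of_nat_closed del: of_nat_fact)
  ultimately obtain b where b: "b \<in> A" "poly f b = 0" "b - a \<in> M"
    using hensel assms(2) by blast
  \<comment> \<open>Since this factorial is non-zero, the exact zero \<open>b\<close> of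
    \<open>f\<close> makes the coefficient itself vanish and not only its residue.\<close>
  have "(of_nat (fact (m - 1)) :: 'a) \<noteq> 0"
    using residue_fact[of "m - 1"] zero_in_M by metis
  then have "Polynomial.coeff (pcompose p [:b, 1:]) (m - 1) = 0"
    using b(2) by (simp add: f_def poly_higher_pderiv del: of_nat_fact)
  then show ?thesis
    using residue_multiplicity_shift[OF assms(3,1,2) b(1,3)] b(1) by blast
qed

text \<open>A zero \<open>b\<close> of full multiplicity \<open>n\<close> would make the reduction
  of \<open>h\<close> equal to \<open>(X - b) ^ n\<close>. The vanishing second coefficient forces
  \<open>n * b\<close>, hence \<open>b\<close>, into \<open>M\<close>; then \<open>h\<close> reduces
  to \<open>X ^ n\<close>, against the unit coefficient at \<open>i\<close>.\<close>

lemma residue_odd_multiplicity_less: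
  assumes "h \<in> PA" "lead_coeff h = 1" "odd (Polynomial.degree h)"
    and "Polynomial.coeff h (Polynomial.degree h - 1) = 0"
    and "i < Polynomial.degree h" "Polynomial.coeff h i \<notin> M"
  shows "\<exists>b\<in>A. \<exists>m. odd m \<and> m < Polynomial.degree h \<and> residue_multiplicity h b m"
proof -
  obtain b m g where b: "b \<in> A" "odd m" "g \<in> PA" "h - [:- b, 1:] ^ m * g \<in> PM" "poly g b \<notin> M"
    using residue_odd_multiplicity[OF assms(1-3)] by blast
  have mult: "residue_multiplicity h b m"
    using residue_multiplicity_cong[OF b(4,1)] residue_multiplicity_factor[OF b(3,5,1)] by simp
  define n where "n = Polynomial.degree h"
  define H where "H = pcompose h [:b, 1:]"
  have degH: "Polynomial.degree H = n"
    by (simp add: H_def n_def degree_pcompose)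
  have "lead_coeff H = 1"
    unfolding H_def using assms(2) by (subst lead_coeff_comp) simp_all
  then have Hn: "Polynomial.coeff H n = 1"
    by (simp add: degH)
  have "m \<le> n"
    using mult Hn one_notin_M by (force simp: residue_multiplicity_def simp flip: H_def intro: leI)
  moreover have "m \<noteq> n"
  proof
    assume "m = n"
    have low: "Polynomial.coeff H j \<in> M" if "j < n" for j
      using mult that \<open>m = n\<close> by (simp add: residue_multiplicity_def H_def)
    have R: "H - Polynomial.monom 1 n \<in> PM"
      using low Hn degH by (auto simp: PM_def coeff_eq_0 zero_in_M linorder_neq_iff)
    have mb: "- b \<in> A"
      using b by (intro uminus_closed)
    have "pcompose H [:- b, 1:] = h"
      by (simp add: H_def shift_shift)
    moreover have "pcompose (Polynomial.monom 1 n) [:- b, 1:] = [:- b, 1:] ^ n"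
      by (induction n) (simp_all add: monom_0 monom_Suc pcompose_pCons one_pCons)
    ultimately have hd: "h - [:- b, 1:] ^ n \<in> PM"
      using PM_pcompose[OF R, of "[:- b, 1:]"] mb one_mem by (simp add: pcompose_diff)
    have "n > 0"
      using assms(3) by (auto simp: n_def intro: odd_pos)
    then have "Polynomial.coeff ([:- b, 1:] ^ n) (n - 1) = of_nat n * - b"
      using coeff_linear_power_minus_1[of "- b" "n - 1"] by simp
    then have "0 - of_nat n * - b \<in> M"
      using hd assms(4) unfolding PM_def n_def by (metis coeff_diff mem_Collect_eq)
    then have "of_nat n * b \<in> M"
      by simp
    moreover have "of_nat n \<notin> M"
      using residue_char_0[of "n - 1"] \<open>n > 0\<close> by simp
    ultimately have "b \<in> M"
      using M_mult_iff[OF of_nat_closed b(1)] by blast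
    then have "H - h \<in> PM"
      unfolding H_def by (intro shift_cong assms(1))
    then have "Polynomial.coeff H i - Polynomial.coeff h i \<in> M"
      by (simp add: PM_def)
    then show False
      using M_cong[of "Polynomial.coeff H i"] low[of i] assms(5,6) by (simp add: n_def)
  qed
  ultimately show ?thesis
    using b mult by (intro bexI[of _ b] exI[of _ m]) (simp_all add: n_def)
qed

text \<open>Descent on \<open>m\<close>: after a Tschirnhaus shift, a rescaling spreads out the
  zeros that coincide modulo \<open>M\<close>, and one of the new residue zeros has smaller odd
  multiplicity.\<close>

lemma lift_odd_multiplicity:
  assumes divisible: "\<And>(x :: 'a) n. \<lbrakk>x \<noteq> 0; n > 0\<rbrakk> \<Longrightarrow> \<exists>y. x = y ^ n \<or> x = - (y ^ n)"
    and "odd m" "p \<in> PA" "a \<in> A" "residue_multiplicity p a m"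
  shows "\<exists>x. poly p x = 0"
  using assms(2-)
proof (induction m arbitrary: p a rule: less_induct)
  case (less m)
  have "m > 0"
    using less.prems(1) by (rule odd_pos)
  then obtain b where b: "b \<in> A" "residue_multiplicity p b m"
    "Polynomial.coeff (pcompose p [:b, 1:]) (m - 1) = 0"
    using tschirnhaus less.prems by blast
  define q where "q = pcompose p [:b, 1:]"
  let ?q = "Polynomial.coeff q"
  have qA: "?q i \<in> A" for i
    using shift_closed[OF less.prems(2) b(1)] by (simp add: q_def PA_def)
  have qm: "?q m \<notin> M" and ql: "i < m \<Longrightarrow> ?q i \<in> M" for i
    using b(2) by (auto simp: q_def residue_multiplicity_def)
  have qm1: "?q (m - 1) = 0"
    using b(3) by (simp add: q_def)
  show ?case
  proof (cases "?q 0 = 0")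
    \<comment> \<open>For \<open>m = 1\<close> only this case occurs, because \<open>qm1\<close>
      then concerns the constant coefficient. The descent thus ends with the use of Hensel's lemma
      in \<open>tschirnhaus\<close>.\<close>
    case True
    then show ?thesis
      by (intro exI[of _ b]) (simp add: q_def)
  next
    case False
    have "\<exists>y. i < m \<and> ?q i \<noteq> 0 \<longrightarrow> ?q i = y ^ (m - i) \<or> ?q i = - (y ^ (m - i))" for i
      using divisible[of "?q i" "m - i"] by auto
    \<comment> \<open>The value of \<open>d i\<close> is the value of \<open>?q i\<close> divided by
      \<open>m - i\<close>, a slope of the Newton polygon.\<close>
    then obtain d where d: "\<And>i. \<lbrakk>i < m; ?q i \<noteq> 0\<rbrakk> \<Longrightarrow> ?q i = d i ^ (m - i) \<or> ?q i = - (d i ^ (m - i))"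
      by metis
    have d0: "d i \<noteq> 0" if "i < m" "?q i \<noteq> 0" for i
      using d[OF that] that by (auto simp: power_0_left)
    define I where "I = {i. i < m \<and> ?q i \<noteq> 0}"
    have "finite (d ` I)" "d ` I \<noteq> {}" "0 \<notin> d ` I"
      using False \<open>m > 0\<close> d0 by (auto simp: I_def)
    from exists_minimal[OF this] obtain k where k: "k < m" "?q k \<noteq> 0"
      and dk: "\<And>i. \<lbrakk>i < m; ?q i \<noteq> 0\<rbrakk> \<Longrightarrow> d i / d k \<in> A"
      by (auto simp: I_def)
    \<comment> \<open>As \<open>c\<close> has least value among the \<open>d i\<close>, scaling by
      \<open>c\<close> makes all coefficients below \<open>m\<close> integral and the one at
      \<open>k\<close> a unit, so that the reduction is no pure power of \<open>X\<close>.\<close>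
    define c where "c = d k"
    have c: "c \<noteq> 0" "c \<in> M"
    proof -
      show "c \<noteq> 0" using d0 k by (simp add: c_def)
      have "c ^ (m - k) \<in> M"
        using d[OF k] ql[OF k(1)] M_uminus[of "?q k"] by (auto simp: c_def)
      moreover have "c \<in> A"
        using \<open>c ^ (m - k) \<in> M\<close> k by (intro A_powerD[of c "m - k"] M_subset) auto
      ultimately show "c \<in> M"
        using M_power by blast
    qed
    define g where "g = Polynomial.smult (inverse (c ^ m)) (pcompose q [:0, c:])"
    let ?g = "Polynomial.coeff g"
    have gc: "?g i = ?q i * c ^ i / c ^ m" for i
      by (simp add: g_def coeff_pcompose_linear field_simps)
    have g_low: "?g i = ?q i / c ^ (m - i)" if "i < m" for i
      using that c by (simp add: gc power_diff)
    have g_high: "?g i \<in> M" if "i > m" for i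
    proof -
      have "?g i = ?q i * c ^ (i - m - 1) * c"
        using that c by (simp add: gc power_diff flip: power_Suc2)
      then show ?thesis
        using c qA by (auto intro!: M_mult'[of _ c] mult_closed power_closed intro: M_subset)
    qed
    have gm: "?g m = ?q m"
      using c by (simp add: gc)
    have gA: "?g i \<in> A" for i
    proof (cases i m rule: linorder_cases)
      case less
      show ?thesis
      proof (cases "?q i = 0")
        case False
        have "(d i / c) ^ (m - i) \<in> A"
          using dk[OF less False] by (simp add: c_def power_closed)
        then show ?thesis
          using d[OF less False] uminus_closed by (auto simp: g_low[OF less] power_divide)
      qed (simp add: gc zero_mem)
    qed (use gm qA g_high M_subset in auto)
    have gk: "?g k \<in> A" "?g k \<notin> M"
    proof -
      have "?g k = 1 \<or> ?g k = - 1"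
        using d[OF k] c k by (auto simp: g_low c_def)
      then show "?g k \<notin> M"
        using one_notin_M M_uminus[of "- 1"] by auto
    qed (rule gA)
    have qm': "?q m \<noteq> 0" "inverse (?q m) \<in> A" "inverse (?q m) \<notin> M"
      using unit_inverse qA qm by auto
    \<comment> \<open>The degree of \<open>g\<close> may exceed \<open>m\<close>, but its
      coefficients there lie in \<open>M\<close>. The truncation \<open>h\<close>, made monic,
      agrees with \<open>g\<close> modulo \<open>M\<close> up to the unit
      \<open>?q m\<close>.\<close>
    define h where "h = (\<Sum>i\<le>m. Polynomial.monom (inverse (?q m) * ?g i) i)"
    have hc: "Polynomial.coeff h i = (if i \<le> m then inverse (?q m) * ?g i else 0)" for i
      by (simp add: h_def Polynomial.coeff_sum)
    have hm: "Polynomial.coeff h m = 1"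
      using qm' by (simp add: hc gm)
    have deg: "Polynomial.degree h = m"
      using hm by (intro antisym degree_le le_degree) (auto simp: hc)
    have hA: "h \<in> PA"
      using gA qm' by (auto simp: PA_def hc zero_mem intro!: mult_closed)
    have gh: "g - Polynomial.smult (?q m) h \<in> PM"
      using qm' g_high by (auto simp: PM_def hc zero_in_M simp flip: mult.assoc)
    have "?g (m - 1) = 0"
      using qm1 by (simp add: gc)
    then have "lead_coeff h = 1" "odd (Polynomial.degree h)" "k < Polynomial.degree h"
      "Polynomial.coeff h (Polynomial.degree h - 1) = 0" "Polynomial.coeff h k \<notin> M"
      using hm less.prems(1) k gk qm' by (auto simp: deg hc M_mult_iff)
    from residue_odd_multiplicity_less[OF hA this(1,2,4,3,5)] obtain e n
      where e: "e \<in> A" "odd n" "n < m" "residue_multiplicity h e n"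
      by (auto simp: deg)
    have "residue_multiplicity g e n"
      using residue_multiplicity_cong[OF gh e(1)]
        residue_multiplicity_smult[OF e(4) hA e(1) qA qm] by simp
    then obtain x where "poly g x = 0"
      using less.IH[OF e(3,2) _ e(1)] gA by (auto simp: PA_def)
    then have "poly p (b + x * c) = 0"
      using c by (simp add: g_def q_def poly_pcompose)
    then show ?thesis ..
  qed
qed

text \<open>A substitution \<open>c * X\<close> and a division make the polynomial monic with
  coefficients in \<open>A\<close>; an odd-multiplicity residue zero then exists and is
  lifted.\<close>

lemma odd_degree_root:
  fixes p :: "'a poly"
  assumes divisible: "\<And>(x :: 'a) n. \<lbrakk>x \<noteq> 0; n > 0\<rbrakk> \<Longrightarrow> \<exists>y. x = y ^ n \<or> x = - (y ^ n)"
    and odd: "odd (Polynomial.degree p)"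
  shows "\<exists>x. poly p x = 0"
proof -
  define n where "n = Polynomial.degree p"
  have "p \<noteq> 0" using odd by auto
  \<comment> \<open>Including 1 ensures that \<open>inverse c\<close> lies in
    \<open>A\<close>.\<close>
  define D where "D = insert 1 ((\<lambda>i. Polynomial.coeff p i / lead_coeff p) ` {i. i \<le> n \<and> Polynomial.coeff p i \<noteq> 0})"
  have "finite D" "D \<noteq> {}" "0 \<notin> D"
    using \<open>p \<noteq> 0\<close> by (auto simp: D_def)
  from exists_minimal[OF this] obtain c where c: "c \<in> D" "\<And>d. d \<in> D \<Longrightarrow> d / c \<in> A" by blast
  have c0: "c \<noteq> 0" and c1: "inverse c \<in> A"
    using c \<open>0 \<notin> D\<close> c(2)[of 1] by (auto simp: D_def divide_inverse)
  define q where "q = Polynomial.smult (inverse (lead_coeff p * c ^ n)) (pcompose p [:0, c:])"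
  have qc: "Polynomial.coeff q i = Polynomial.coeff p i * c ^ i / (lead_coeff p * c ^ n)" for i
    by (simp add: q_def coeff_pcompose_linear field_simps)
  have deg: "Polynomial.degree q = n"
    using c0 \<open>p \<noteq> 0\<close> by (simp add: q_def n_def degree_pcompose)
  have lead: "lead_coeff q = 1"
    unfolding deg using c0 \<open>p \<noteq> 0\<close> by (simp add: qc n_def)
  have qA: "q \<in> PA"
    unfolding PA_def mem_Collect_eq
  proof
    fix i
    show "Polynomial.coeff q i \<in> A"
    proof (cases i n rule: linorder_cases)
      case less
      show ?thesis
      proof (cases "Polynomial.coeff p i = 0")
        case False
        obtain j where j: "n = Suc (i + j)"
          using less less_imp_Suc_add by blast
        \<comment> \<open>Of the \<open>n - i\<close> factors \<open>inverse c\<close>, one brings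
          the coefficient into \<open>A\<close> by minimality of \<open>c\<close>; the other
          \<open>j\<close> lie in \<open>A\<close> themselves.\<close>
        have "Polynomial.coeff p i / lead_coeff p / c * inverse c ^ j \<in> A"
          using less False c1 by (intro mult_closed power_closed c(2)) (auto simp: D_def)
        also have "Polynomial.coeff p i / lead_coeff p / c * inverse c ^ j = Polynomial.coeff q i"
          using c0 \<open>p \<noteq> 0\<close> by (simp add: qc j power_add field_simps)
        finally show ?thesis .
      qed (simp add: qc zero_mem)
    next
      case equal
      then show ?thesis using lead deg by (simp add: one_mem)
    next
      case greater
      then show ?thesis using deg by (simp add: coeff_eq_0 zero_mem)
    qed
  qed
  obtain b m g where b: "b \<in> A" "odd m" "g \<in> PA" "q - [:- b, 1:] ^ m * g \<in> PM" "poly g b \<notin> M"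
    using residue_odd_multiplicity[OF qA lead] odd deg by (auto simp: n_def)
  have "residue_multiplicity q b m"
    using residue_multiplicity_cong[OF b(4,1)] residue_multiplicity_factor[OF b(3,5,1)] by simp
  then obtain x where "poly q x = 0"
    using lift_odd_multiplicity[OF divisible b(2) qA b(1)] by blast
  then have "poly p (x * c) = 0"
    using c0 \<open>p \<noteq> 0\<close> by (simp add: q_def poly_pcompose)
  then show ?thesis ..
qed

end

section \<open>Signed powers and definable coarsenings\<close>

text \<open>The sign is essential for even \<open>n\<close>: over a real closed residue field,
  negative units are not even powers.\<close>

definition signed_powers :: "nat \<Rightarrow> 'a::field set" where
  "signed_powers n = {x. \<exists>y. y \<noteq> 0 \<and> (x = y ^ n \<or> x = - (y ^ n))}"

lemma signed_powers_mult: "\<lbrakk>x \<in> signed_powers n; y \<in> signed_powers n\<rbrakk> \<Longrightarrow> x * y \<in> signed_powers n"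
proof -
  assume "x \<in> signed_powers n" "y \<in> signed_powers n"
  then obtain a b where "a \<noteq> 0" "x = a ^ n \<or> x = - (a ^ n)" "b \<noteq> 0" "y = b ^ n \<or> y = - (b ^ n)"
    by (auto simp: signed_powers_def)
  then show ?thesis
    by (auto simp: signed_powers_def power_mult_distrib intro!: exI[of _ "a * b"])
qed

lemma signed_powers_inverse: "x \<in> signed_powers n \<Longrightarrow> inverse x \<in> signed_powers n"
proof -
  assume "x \<in> signed_powers n"
  then obtain a where "a \<noteq> 0" "x = a ^ n \<or> x = - (a ^ n)"
    by (auto simp: signed_powers_def)
  then show ?thesis
    by (auto simp: signed_powers_def power_inverse intro!: exI[of _ "inverse a"])
qed

lemma signed_powers_nonzero: "x \<in> signed_powers n \<Longrightarrow> x \<noteq> 0"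
  by (auto simp: signed_powers_def)

text \<open>Hensel's lemma is applied to \<open>X ^ n - u\<close>. Its derivative at
  \<open>y\<close> is a unit because \<open>y ^ n\<close> is congruent to the unit
  \<open>u\<close>.\<close>

lemma (in henselian_subring) residue_power_lift:
  assumes "u \<in> A" "u \<notin> M" "y \<in> A" "y ^ n - u \<in> M" "of_nat n \<notin> M"
  shows "\<exists>z\<in>A. z ^ n = u"
proof -
  have "n \<noteq> 0"
    using assms(5) zero_in_M by (intro notI) simp
  define f where "f = Polynomial.monom 1 n - [:u:]"
  have "f \<in> PA"
    unfolding f_def using assms one_mem by (intro PA_diff PA_monom) auto
  moreover have "poly f y \<in> M"
    using assms by (simp add: f_def poly_monom)
  moreover have "poly (pderiv f) y = of_nat n * y ^ (n - 1)"
    by (simp add: f_def pderiv_diff pderiv_monom poly_monom pderiv_pCons)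
  moreover have "of_nat n * y ^ (n - 1) \<notin> M"
  proof
    assume "of_nat n * y ^ (n - 1) \<in> M"
    then have "y ^ (n - 1) \<in> M"
      using M_mult_iff assms of_nat_closed power_closed by blast
    then have "y \<in> M"
      using M_power assms by blast
    then have "y ^ n \<in> M"
      using \<open>n \<noteq> 0\<close> power_closed[OF assms(3)] by (cases n) (auto intro: M_mult)
    then show False
      using M_cong[OF assms(4)] assms(2) by simp
  qed
  ultimately obtain z where "z \<in> A" "poly f z = 0"
    using hensel assms(3) by force
  then show ?thesis
    by (auto simp: f_def poly_monom)
qed

text \<open>For odd \<open>n\<close> the residue zero of \<open>X ^ n - u\<close> is lifted. For
  \<open>n = 2 * k\<close> induction gives a signed \<open>k\<close>-th power of some
  \<open>w\<close>, and \<open>w\<close> is a signed square.\<close>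

lemma (in real_closed_residue) units_subset_signed_powers:
  assumes "u \<in> A" "u \<notin> M" "n > 0"
  shows "u \<in> signed_powers n"
  using assms
proof (induction n arbitrary: u rule: less_induct)
  case (less n)
  have char0: "of_nat n \<notin> M" if "n > 0" for n
    using residue_char_0[of "n - 1"] that by simp
  have lift: "\<exists>z. z \<noteq> 0 \<and> z ^ k = u" if "k > 0" "u \<in> A" "u \<notin> M" "y \<in> A" "y ^ k - u \<in> M" for k u y
    using residue_power_lift[OF that(2-5) char0[OF that(1)]] that(1,3) zero_in_M
    by (metis power_0_left less_irrefl)
  have neg: "- w \<notin> M" if "w \<notin> M" for w
    using that M_uminus[of "- w"] by auto
  show ?case
  proof (cases "odd n")
    case True
    define f where "f = Polynomial.monom 1 n - [:u:]"
    have "f \<in> PA"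
      unfolding f_def using less.prems one_mem by (intro PA_diff PA_monom) auto
    moreover have lead: "Polynomial.coeff f n = 1"
      using less.prems by (cases n) (simp_all add: f_def)
    moreover have "Polynomial.degree f = n"
      using lead by (intro antisym degree_le le_degree) (auto simp: f_def coeff_pCons split: nat.splits)
    ultimately obtain y where "y \<in> A" "poly f y \<in> M"
      using residue_odd_degree[of f] True by auto
    then show ?thesis
      using lift[of n u y] less.prems by (auto simp: signed_powers_def f_def poly_monom)
  next
    case False
    then obtain k where k: "n = 2 * k" "k < n" "k > 0"
      using less.prems by (auto elim!: evenE)
    obtain w where w: "w \<noteq> 0" "u = w ^ k \<or> u = - (w ^ k)"
      using less.IH[OF k(2) less.prems(1,2) k(3)] by (auto simp: signed_powers_def)
    have "w ^ k \<in> A" "w ^ k \<notin> M"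
      using w(2) less.prems(1,2) uminus_closed[of u] neg[of u] by auto
    then have "w \<in> A"
      using A_powerD k by blast
    moreover have "w \<notin> M"
    proof
      assume "w \<in> M"
      then show False
        using \<open>w ^ k \<notin> M\<close> k power_closed[OF \<open>w \<in> A\<close>] by (cases k) (auto intro: M_mult)
    qed
    ultimately obtain y where y: "y \<in> A" "w - y * y \<in> M \<or> w + y * y \<in> M"
      using residue_squares by blast
    have "\<exists>z. z \<noteq> 0 \<and> (z ^ 2 = w \<or> - (z ^ 2) = w)"
      using y(2)
    proof
      assume "w - y * y \<in> M"
      then have "y ^ 2 - w \<in> M"
        using M_uminus[of "w - y * y"] by (simp add: power2_eq_square)
      then show ?thesis
        using lift[of 2 w y] \<open>w \<in> A\<close> \<open>w \<notin> M\<close> y by auto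
    next
      assume "w + y * y \<in> M"
      then have "y ^ 2 - - w \<in> M"
        by (simp add: power2_eq_square add.commute)
      then obtain z where "z \<noteq> 0" "z ^ 2 = - w"
        using lift[of 2 "- w" y] neg[of w] \<open>w \<notin> M\<close> y uminus_closed[OF \<open>w \<in> A\<close>] by auto
      then show ?thesis
        by (intro exI[of _ z]) simp
    qed
    then obtain z where z: "z \<noteq> 0" "w = z ^ 2 \<or> w = - (z ^ 2)"
      by metis
    \<comment> \<open>The sign of \<open>w\<close> survives in \<open>w ^ k\<close> only for odd
      \<open>k\<close>, and there it is absorbed by the sign allowed in
      \<open>signed_powers\<close>.\<close>
    then have "w ^ k = z ^ n \<or> w ^ k = - (z ^ n)"
      unfolding k(1) by (cases "even k") (auto simp: power_mult)
    then show ?thesis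
      using w z by (auto simp: signed_powers_def)
  qed
qed

text \<open>Containing all units, \<open>T\<close> is the full preimage of a proper subgroup of the
  value group.\<close>

locale units_in_subgroup = valuation_subring +
  fixes T :: "'a set"
  assumes T_mult: "\<lbrakk>x \<in> T; y \<in> T\<rbrakk> \<Longrightarrow> x * y \<in> T"
    and T_inverse: "x \<in> T \<Longrightarrow> inverse x \<in> T"
    and T_nonzero: "0 \<notin> T"
    and units_in_T: "\<lbrakk>x \<in> A; x \<notin> M\<rbrakk> \<Longrightarrow> x \<in> T"
    and T_proper: "\<exists>x. x \<noteq> 0 \<and> x \<notin> T"
begin

text \<open>
  With value group \<open>\<Gamma>\<close>, the elements of \<open>B\<close> are those whose value is at least the negative of an element of
  the largest convex subgroup contained in the image of \<open>T\<close> in \<open>\<Gamma>\<close>.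
\<close>

definition B :: "'a set" where
  "B = {x. x = 0 \<or> (\<forall>y\<in>A - {0}. inverse (x * y) \<in> A \<longrightarrow> y \<in> T)}"

lemma B_I: "(\<And>y. \<lbrakk>y \<in> A; y \<noteq> 0; inverse (x * y) \<in> A; x \<noteq> 0\<rbrakk> \<Longrightarrow> y \<in> T) \<Longrightarrow> x \<in> B"
  by (auto simp: B_def)

lemma B_D: "\<lbrakk>x \<in> B; x \<noteq> 0; y \<in> A; y \<noteq> 0; inverse (x * y) \<in> A\<rbrakk> \<Longrightarrow> y \<in> T"
  by (auto simp: B_def)

lemma A_subset_B: "A \<subseteq> B"
proof
  fix x assume x: "x \<in> A"
  show "x \<in> B"
  proof (rule B_I)
    fix y assume y: "y \<in> A" "y \<noteq> 0" "inverse (x * y) \<in> A" "x \<noteq> 0"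
    have "x * inverse (x * y) \<in> A"
      using x y by (intro mult_closed)
    then have "inverse y \<in> A"
      using y by (simp add: field_simps)
    then show "y \<in> T"
      using y by (intro units_in_T) (auto simp: M_def)
  qed
qed

text \<open>Written additively, \<open>x\<close> lies in \<open>B\<close> when all values between 0
  and \<open>- v x\<close> come from \<open>T\<close>. A value between 0 and
  \<open>- v x - v y\<close> is covered by one of the two intervals, or splits as
  \<open>z = inverse y * (y * z)\<close> with one factor in each.\<close>

lemma B_mult: assumes "x \<in> B" "y \<in> B" shows "x * y \<in> B"
proof (rule B_I)
  fix z assume z: "z \<in> A" "z \<noteq> 0" "inverse (x * y * z) \<in> A" "x * y \<noteq> 0"
  then have nz: "x \<noteq> 0" "y \<noteq> 0" by auto
  consider "inverse (y * z) \<in> A" | "y \<in> A" | "y * z \<in> A" "inverse y \<in> A"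
    using total[of "y * z"] total[of y] by blast
  then show "z \<in> T"
  proof cases
    case 1
    then show ?thesis using B_D assms z nz by blast
  next
    case 2
    have "y * inverse (x * y * z) \<in> A"
      using 2 z by (intro mult_closed)
    then have "inverse (x * z) \<in> A"
      using nz z by (simp add: field_simps)
    then show ?thesis using B_D assms z nz by blast
  next
    case 3
    have "y * z \<in> T"
      using 3 z nz B_D[OF assms(1), of "y * z"] by (simp add: mult.assoc)
    moreover have "inverse y \<in> T"
      using 3 nz B_D[OF assms(2), of "inverse y"] one_mem by simp
    ultimately have "inverse y * (y * z) \<in> T"
      using T_mult by blast
    then show ?thesis using nz by (simp add: field_simps)
  qed
qed

lemma B_valuation_subring: "valuation_subring B"
proof
  show "1 \<in> B" "x \<in> B \<or> inverse x \<in> B" for x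
    using A_subset_B one_mem total[of x] by auto
  have "- 1 \<in> B"
    using A_subset_B one_mem uminus_closed[of 1] by auto
  then show "- x \<in> B" if "x \<in> B" for x
    using B_mult[of "- 1" x] that by simp
  show "x * y \<in> B" if "x \<in> B" "y \<in> B" for x y
    using that by (rule B_mult)
  have add: "x + y \<in> B" if "x \<in> B" "y / x \<in> A" "x \<noteq> 0" for x y
  proof -
    have "x * (1 + y / x) \<in> B"
      using that A_subset_B add_closed one_mem by (intro B_mult) auto
    then show ?thesis
      using that by (simp add: distrib_left)
  qed
  show "x + y \<in> B" if "x \<in> B" "y \<in> B" for x y
  proof (cases "x = 0 \<or> y = 0")
    case False
    then have "y / x \<in> A \<or> x / y \<in> A"
      using total[of "y / x"] by simp
    then show ?thesis
      using add[of x y] add[of y x] that False by (auto simp: add.commute)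
  qed (use that in auto)
qed

text \<open>Of an element outside \<open>T\<close> and its inverse, one lies in \<open>A\<close>; it
  witnesses that the other is not in \<open>B\<close>.\<close>

lemma B_proper: "B \<noteq> UNIV"
proof -
  obtain x where x: "x \<noteq> 0" "x \<notin> T"
    using T_proper by blast
  have *: "inverse y \<notin> B" if "y \<noteq> 0" "y \<notin> T" "y \<in> A" for y
    using that B_D[of "inverse y" y] one_mem by auto
  have "inverse x \<notin> T"
    using x T_inverse[of "inverse x"] by auto
  then show ?thesis
    using *[of x] *[of "inverse x"] x total[of x] by auto
qed

text \<open>Outside \<open>T\<close> there are no units. For \<open>y\<close> in \<open>M\<close>
  the element \<open>1 + y\<close> is a unit; for \<open>y\<close> outside \<open>A\<close> it is
  \<open>y\<close> times the unit \<open>1 + inverse y\<close>, so it stays outside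
  \<open>T\<close>.\<close>

lemma one_add_in_T_iff:
  assumes "y \<notin> T" shows "1 + y \<in> T \<longleftrightarrow> y \<in> M"
proof
  assume T: "1 + y \<in> T"
  show "y \<in> M"
  proof (rule ccontr)
    assume "y \<notin> M"
    then have "y \<notin> A"
      using assms units_in_T by blast
    then have "y \<noteq> 0" "1 + inverse y \<in> A" "1 + inverse y \<notin> M"
      using zero_mem one_add_M[OF notin_imp_inverse_in_M] by auto
    then have "inverse (1 + inverse y) \<in> T"
      using units_in_T T_inverse by blast
    moreover have "1 + inverse y \<noteq> 0"
      using \<open>1 + inverse y \<notin> M\<close> zero_in_M by metis
    then have "(1 + y) * inverse (1 + inverse y) = y"
      using \<open>y \<noteq> 0\<close> by (simp add: field_simps)
    ultimately show False
      using T_mult[OF T] assms by metis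
  qed
qed (use one_add_M units_in_T in blast)

text \<open>
  The formula is that of the theory of rigid elements (Arason, Elman, Jacob).
\<close>

lemma B_eq: "B = {x. (x \<notin> T \<and> 1 + x \<in> T) \<or>
  (x \<in> T \<and> (\<forall>y. y \<notin> T \<and> 1 + y \<in> T \<longrightarrow> 1 + x * y \<in> T))}"
proof -
  \<comment> \<open>For \<open>x\<close> outside \<open>A\<close>, the element
    \<open>inverse x\<close> itself would be forced into \<open>T\<close> by membership of
    \<open>x\<close> in \<open>B\<close>.\<close>
  have "x \<in> B \<longleftrightarrow> x \<in> M" if "x \<notin> T" for x
  proof
    assume "x \<in> B"
    have "x \<in> A"
    proof (rule ccontr)
      assume "x \<notin> A"
      then have "x \<noteq> 0" "inverse x \<in> A"
        using total[of x] zero_mem by auto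
      then have "inverse x \<in> T"
        using B_D[OF \<open>x \<in> B\<close>, of "inverse x"] one_mem by simp
      then show False
        using T_inverse[of "inverse x"] that by simp
    qed
    then show "x \<in> M"
      using units_in_T that by blast
  qed (use A_subset_B M_subset in blast)
  \<comment> \<open>This is the contrapositive of the condition in \<open>B\<close>: outside
    \<open>T\<close>, membership in \<open>A\<close> and in \<open>M\<close> coincide.\<close>
  moreover have "x \<in> B \<longleftrightarrow> (\<forall>y. y \<notin> T \<and> y \<in> M \<longrightarrow> x * y \<in> M)" if x: "x \<in> T" for x
  proof (intro iffI allI impI)
    fix y assume "x \<in> B" "y \<notin> T \<and> y \<in> M"
    then show "x * y \<in> M"
      using B_D[of x y] T_nonzero x M_subset[of y] notin_imp_inverse_in_M[of "inverse (x * y)"]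
        total[of "x * y"] by (cases "y = 0") (auto simp: M_def)
  next
    assume *: "\<forall>y. y \<notin> T \<and> y \<in> M \<longrightarrow> x * y \<in> M"
    show "x \<in> B"
    proof (rule B_I, rule ccontr)
      fix y assume y: "y \<in> A" "y \<noteq> 0" "inverse (x * y) \<in> A" "x \<noteq> 0" "y \<notin> T"
      then have "x * y \<in> M"
        using * units_in_T by blast
      then show False
        using y by (auto simp: M_def)
    qed
  qed
  \<comment> \<open>Hence \<open>one_add_in_T_iff\<close> also applies to
    \<open>x * y\<close>.\<close>
  moreover have "x * y \<notin> T" if "x \<in> T" "y \<notin> T" for x y
  proof
    assume "x * y \<in> T"
    then have "inverse x * (x * y) \<in> T"
      using T_mult T_inverse that by blast
    moreover have "x \<noteq> 0"
      using that T_nonzero by metis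
    then have "inverse x * (x * y) = y" by simp
    ultimately show False using that by simp
  qed
  ultimately show ?thesis
    using one_add_in_T_iff by (auto; metis)
qed

end

section \<open>Valuations and valuation rings\<close>

context valuation_subring
begin

definition unit_coset :: "'a \<Rightarrow> 'a set" where
  "unit_coset x = {y. y \<noteq> 0 \<and> y / x \<in> A \<and> x / y \<in> A}"

definition coset_group :: "'a set ordered_group" where
  "coset_group = \<lparr>carrier = unit_coset ` (UNIV - {0}),
     monoid.mult = (\<lambda>C D. {x * y | x y. x \<in> C \<and> y \<in> D}),
     one = unit_coset 1,
     grp_le = {(C, D). \<exists>x y. x \<noteq> 0 \<and> y \<noteq> 0 \<and> C = unit_coset x \<and> D = unit_coset y \<and> y / x \<in> A}\<rparr>"

lemma coset_group_simps [simp]: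
  "carrier coset_group = unit_coset ` (UNIV - {0})"
  "\<one>\<^bsub>coset_group\<^esub> = unit_coset 1"
  by (simp_all add: coset_group_def)

lemma div_trans: "\<lbrakk>x / y \<in> A; y / z \<in> A; y \<noteq> 0\<rbrakk> \<Longrightarrow> x / z \<in> A"
  using mult_closed[of "x / y" "y / z"] by simp

lemma unit_coset_eq_iff:
  assumes "x \<noteq> 0" "y \<noteq> 0"
  shows "unit_coset x = unit_coset y \<longleftrightarrow> x / y \<in> A \<and> y / x \<in> A"
proof
  assume "unit_coset x = unit_coset y"
  moreover have "x \<in> unit_coset x"
    using assms one_mem by (simp add: unit_coset_def)
  ultimately show "x / y \<in> A \<and> y / x \<in> A"
    by (auto simp: unit_coset_def)
next
  assume "x / y \<in> A \<and> y / x \<in> A"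
  then show "unit_coset x = unit_coset y"
    using assms div_trans[of _ x y] div_trans[of _ y x] div_trans[of x y] div_trans[of y x]
    unfolding unit_coset_def by blast
qed

lemma unit_coset_mult:
  assumes "x \<noteq> 0" "y \<noteq> 0"
  shows "unit_coset x \<otimes>\<^bsub>coset_group\<^esub> unit_coset y = unit_coset (x * y)"
proof (intro Set.set_eqI iffI)
  fix z assume "z \<in> unit_coset x \<otimes>\<^bsub>coset_group\<^esub> unit_coset y"
  then obtain a b where ab: "z = a * b" "a \<in> unit_coset x" "b \<in> unit_coset y"
    by (auto simp: coset_group_def)
  then show "z \<in> unit_coset (x * y)"
    using mult_closed[of "a / x" "b / y"] mult_closed[of "x / a" "y / b"]
    by (auto simp: unit_coset_def)
next
  fix z assume z: "z \<in> unit_coset (x * y)"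
  have "y \<in> unit_coset y"
    using assms one_mem by (simp add: unit_coset_def)
  moreover have "z / y \<in> unit_coset x"
    using z assms by (simp add: unit_coset_def mult.commute)
  moreover have "z = z / y * y"
    using assms by simp
  ultimately have "\<exists>a b. z = a * b \<and> a \<in> unit_coset x \<and> b \<in> unit_coset y"
    by blast
  then show "z \<in> unit_coset x \<otimes>\<^bsub>coset_group\<^esub> unit_coset y"
    by (simp add: coset_group_def)
qed

text \<open>The order is defined through some pair of representatives; here it is shown that any
  pair decides it.\<close>

lemma coset_le_iff:
  assumes "x \<noteq> 0" "y \<noteq> 0"
  shows "(unit_coset x, unit_coset y) \<in> grp_le coset_group \<longleftrightarrow> y / x \<in> A"
proof
  assume "(unit_coset x, unit_coset y) \<in> grp_le coset_group"
  then obtain a b where ab: "a \<noteq> 0" "b \<noteq> 0" "b / a \<in> A"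
    "unit_coset x = unit_coset a" "unit_coset y = unit_coset b"
    by (auto simp: coset_group_def)
  then have "y / b \<in> A" "a / x \<in> A"
    using assms unit_coset_eq_iff by auto
  then show "y / x \<in> A"
    using ab div_trans[of y b a] div_trans[of y a x] by blast
qed (use assms in \<open>auto simp: coset_group_def\<close>)

lemma coset_valuation: "valuation coset_group unit_coset"
proof -
  interpret comm_group coset_group
  proof (rule comm_groupI)
    fix C assume "C \<in> carrier coset_group"
    then obtain x where x: "C = unit_coset x" "x \<noteq> 0" by auto
    show "\<exists>D\<in>carrier coset_group. D \<otimes>\<^bsub>coset_group\<^esub> C = \<one>\<^bsub>coset_group\<^esub>"
      using x by (intro bexI[of _ "unit_coset (inverse x)"]) (auto simp: unit_coset_mult)
  qed (auto simp: unit_coset_mult mult_ac)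
  show ?thesis
  proof
    show "linear_order_on (carrier coset_group) (grp_le coset_group)"
      unfolding linear_order_on_def partial_order_on_def preorder_on_def refl_on_def total_on_def
    proof (intro conjI ballI impI)
      show "grp_le coset_group \<subseteq> carrier coset_group \<times> carrier coset_group"
        by (auto simp: coset_group_def)
      show "(C, C) \<in> grp_le coset_group" if C: "C \<in> carrier coset_group" for C
      proof -
        obtain x where "C = unit_coset x" "x \<noteq> 0"
          using C by auto
        then show ?thesis
          using one_mem by (simp add: coset_le_iff)
      qed
      show "trans (grp_le coset_group)"
      proof (rule transI)
        fix C D E assume XY: "(C, D) \<in> grp_le coset_group" and YZ: "(D, E) \<in> grp_le coset_group"
        then obtain x y z where "C = unit_coset x" "x \<noteq> 0" "D = unit_coset y" "y \<noteq> 0"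
          "E = unit_coset z" "z \<noteq> 0"
          by (auto simp: coset_group_def)
        then show "(C, E) \<in> grp_le coset_group"
          using XY YZ div_trans[of z y x] by (simp add: coset_le_iff)
      qed
      show "antisym (grp_le coset_group)"
      proof (rule antisymI)
        fix C D assume XY: "(C, D) \<in> grp_le coset_group" and YX: "(D, C) \<in> grp_le coset_group"
        then obtain x y where "C = unit_coset x" "x \<noteq> 0" "D = unit_coset y" "y \<noteq> 0"
          by (auto simp: coset_group_def)
        then show "C = D"
          using XY YX by (simp add: coset_le_iff unit_coset_eq_iff)
      qed
      show "(C, D) \<in> grp_le coset_group \<or> (D, C) \<in> grp_le coset_group"
        if C: "C \<in> carrier coset_group" and D: "D \<in> carrier coset_group" for C D
      proof -
        obtain x y where "C = unit_coset x" "x \<noteq> 0" "D = unit_coset y" "y \<noteq> 0"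
          using C D by auto
        then show ?thesis
          using total[of "y / x"] by (simp add: coset_le_iff)
      qed
    qed
    show "(C \<otimes>\<^bsub>coset_group\<^esub> E, D \<otimes>\<^bsub>coset_group\<^esub> E) \<in> grp_le coset_group"
      if XY: "(C, D) \<in> grp_le coset_group" and E: "E \<in> carrier coset_group" for C D E
    proof -
      obtain x y z where "C = unit_coset x" "x \<noteq> 0" "D = unit_coset y" "y \<noteq> 0" "E = unit_coset z" "z \<noteq> 0"
        using XY E by (auto simp: coset_group_def)
      then show ?thesis
        using XY by (simp add: unit_coset_mult coset_le_iff)
    qed
    show "unit_coset ` (UNIV - {0}) = carrier coset_group"
      by simp
    show "unit_coset (x * y) = unit_coset x \<otimes>\<^bsub>coset_group\<^esub> unit_coset y" if "x \<noteq> 0" "y \<noteq> 0" for x y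
      using that by (simp add: unit_coset_mult)
    show "(unit_coset x, unit_coset (x + y)) \<in> grp_le coset_group \<or>
        (unit_coset y, unit_coset (x + y)) \<in> grp_le coset_group"
      if "x \<noteq> 0" "y \<noteq> 0" "x + y \<noteq> 0" for x y
      using that total[of "y / x"] add_closed[of 1 "y / x"] add_closed[of "x / y" 1] one_mem
      by (auto simp: coset_le_iff add_divide_distrib)
  qed
qed

lemma coset_valuation_ring: "valuation_ring coset_group unit_coset = A"
proof -
  have "x \<in> valuation_ring coset_group unit_coset \<longleftrightarrow> x \<in> A" for x
    using coset_le_iff[of 1 x] zero_mem by (cases "x = 0") (simp_all add: valuation_ring_def)
  then show ?thesis by blast
qed

lemma coset_valuation_ideal: "valuation_ideal coset_group unit_coset = M"
proof -
  have "x \<in> valuation_ideal coset_group unit_coset \<longleftrightarrow> x \<in> M" for x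
    using coset_le_iff[of 1 x] unit_coset_eq_iff[of x 1] zero_mem
    by (cases "x = 0") (auto simp: valuation_ideal_def M_def divide_inverse)
  then show ?thesis by blast
qed

lemma coset_valuation_nontrivial:
  assumes "A \<noteq> UNIV" shows "nontrivial_valuation coset_group unit_coset"
proof -
  obtain x where "x \<notin> A" using assms by auto
  moreover from this have "x \<noteq> 0" using zero_mem by auto
  ultimately show ?thesis
    using unit_coset_eq_iff[of x 1] by (auto simp: nontrivial_valuation_def)
qed

end

lemma (in henselian_subring) coset_valuation_henselian: "henselian coset_group unit_coset"
  unfolding henselian_def coset_valuation_ring coset_valuation_ideal
  using hensel by (simp add: PA_def)

section \<open>The formula defining the coarsened ring\<close>

lemma zero_definable_signed_powers_formula:
  fixes n :: nat
  defines "T \<equiv> signed_powers n :: 'a::field set"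
  shows "zero_definable_set {x :: 'a. (x \<notin> T \<and> 1 + x \<in> T) \<or>
    (x \<in> T \<and> (\<forall>y. y \<notin> T \<and> 1 + y \<in> T \<longrightarrow> 1 + x * y \<in> T))}"
proof -
  define pow where "pow = (\<lambda>t. rec_nat TOne (\<lambda>_. TMult t))"
  have pow_val: "term_val e (pow t k) = term_val e t ^ k" for e :: "nat \<Rightarrow> 'a" and t k
    by (induction k) (simp_all add: pow_def)
  have pow_vars: "term_vars (pow t k) \<subseteq> term_vars t" for t k
    by (induction k) (auto simp: pow_def)
  \<comment> \<open>Variable 2 is reserved for the root. The terms tested below contain only the
    variables 0 and 1, so nothing is captured.\<close>
  define inT where "inT = (\<lambda>t. FEx 2 (FAnd (FNot (FEq (TVar 2) TZero))
    (FOr (FEq t (pow (TVar 2) n)) (FEq t (TNeg (pow (TVar 2) n))))))"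
  have inT_vars: "free_vars (inT t) \<subseteq> term_vars t" for t
    using pow_vars[of "TVar 2" n] by (auto simp: inT_def)
  have term_val_upd: "term_val (e(k := z)) t = term_val e t" if "k \<notin> term_vars t"
    for e :: "nat \<Rightarrow> 'a" and k z t
    using that by (induction t) auto
  have inT_sat: "sat e (inT t) \<longleftrightarrow> term_val e t \<in> T" if "2 \<notin> term_vars t" for e :: "nat \<Rightarrow> 'a" and t
    using that by (simp add: inT_def T_def signed_powers_def pow_val term_val_upd)
  define \<phi> where "\<phi> = (let x = TVar 0; y = TVar 1 in
    FOr (FAnd (FNot (inT x)) (inT (TAdd TOne x)))
      (FAnd (inT x) (FAll 1 (FImp (FAnd (FNot (inT y)) (inT (TAdd TOne y)))
        (inT (TAdd TOne (TMult x y)))))))"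
  have "free_vars \<phi> \<subseteq> {0}"
    using inT_vars[of "TVar 0"] inT_vars[of "TAdd TOne (TVar 0)"] inT_vars[of "TVar 1"]
      inT_vars[of "TAdd TOne (TVar 1)"] inT_vars[of "TAdd TOne (TMult (TVar 0) (TVar 1))"]
    by (auto simp: \<phi>_def Let_def)
  then show ?thesis
    unfolding zero_definable_set_def
    by (intro exI[of _ \<phi>]) (auto simp: \<phi>_def Let_def inT_sat)
qed

section \<open>The valuation ring of a given valuation\<close>

context valuation
begin

abbreviation le (infix "\<preceq>" 50) where "x \<preceq> y \<equiv> (x, y) \<in> grp_le G"

lemma v_closed: "x \<noteq> 0 \<Longrightarrow> v x \<in> carrier G"
  using v_onto by auto

lemma v_one: "v 1 = \<one>"
  using v_mult[of 1 1] v_closed[of 1] by simp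

lemma v_inverse: "x \<noteq> 0 \<Longrightarrow> v x \<otimes> v (inverse x) = \<one>"
  using v_mult[of x "inverse x"] by (simp add: v_one)

lemma grp_le_refl: "x \<in> carrier G \<Longrightarrow> x \<preceq> x"
  and grp_le_antisym: "\<lbrakk>x \<preceq> y; y \<preceq> x\<rbrakk> \<Longrightarrow> x = y"
  and grp_le_trans: "\<lbrakk>x \<preceq> y; y \<preceq> z\<rbrakk> \<Longrightarrow> x \<preceq> z"
  using grp_le_linear
  unfolding linear_order_on_def partial_order_on_def preorder_on_def refl_on_def
  by (auto dest: transD antisymD)

lemma grp_le_total: "\<lbrakk>x \<in> carrier G; y \<in> carrier G\<rbrakk> \<Longrightarrow> x \<preceq> y \<or> y \<preceq> x"
  using grp_le_linear grp_le_refl[of x] unfolding linear_order_on_def total_on_def by (cases "x = y") auto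

lemma v_inverse_le_iff:
  assumes "x \<noteq> 0" shows "\<one> \<preceq> v (inverse x) \<longleftrightarrow> v x \<preceq> \<one>"
  using grp_le_mult[of \<one> "v (inverse x)" "v x"] grp_le_mult[of "v x" \<one> "v (inverse x)"]
    v_closed[of x] v_closed[of "inverse x"] v_inverse[of x] assms
  by (auto simp: m_comm)

lemma v_mult_nonneg:
  assumes "x \<noteq> 0" "y \<noteq> 0" "\<one> \<preceq> v x" "\<one> \<preceq> v y" shows "\<one> \<preceq> v (x * y)"
  using grp_le_mult[of \<one> "v x" "v y"] assms grp_le_trans v_closed by (simp add: v_mult)

text \<open>Since \<open>- 1\<close> is its own inverse, either comparison of its value with
  \<open>\<one>\<close> implies the other.\<close>

lemma v_uminus_one_nonneg: "\<one> \<preceq> v (- 1)"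
  using grp_le_total[of \<one> "v (- 1)"] v_closed[of "- 1"] v_inverse_le_iff[of "- 1"] by auto

lemma valuation_subring: "valuation_subring (valuation_ring G v)"
proof
  show "1 \<in> valuation_ring G v"
    using grp_le_refl by (simp add: valuation_ring_def v_one)
  have mult: "x * y \<in> valuation_ring G v" if "x \<in> valuation_ring G v" "y \<in> valuation_ring G v" for x y
    using that v_mult_nonneg by (auto simp: valuation_ring_def)
  then show "x * y \<in> valuation_ring G v" if "x \<in> valuation_ring G v" "y \<in> valuation_ring G v" for x y
    using that .
  show "- x \<in> valuation_ring G v" if "x \<in> valuation_ring G v" for x
    using mult[of "- 1" x] that v_uminus_one_nonneg by (simp add: valuation_ring_def)
  show "x + y \<in> valuation_ring G v" if "x \<in> valuation_ring G v" "y \<in> valuation_ring G v" for x y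
    using that v_add[of x y] grp_le_trans[of \<one> _ "v (x + y)"]
    by (cases "x = 0 \<or> y = 0 \<or> x + y = 0") (auto simp: valuation_ring_def)
  show "x \<in> valuation_ring G v \<or> inverse x \<in> valuation_ring G v" for x
    using grp_le_total[of \<one> "v x"] v_closed[of x] v_inverse_le_iff[of x]
    by (auto simp: valuation_ring_def)
qed

sublocale valuation_subring "valuation_ring G v"
  by (rule valuation_subring)

lemma valuation_ideal_eq_M: "valuation_ideal G v = M"
proof -
  have "x \<in> valuation_ideal G v \<longleftrightarrow> x \<in> M" for x
    unfolding valuation_ideal_def M_def
    using v_inverse_le_iff[of x] grp_le_antisym[of "v x" \<one>] grp_le_refl[of \<one>]
    by (cases "x = 0") (auto simp: valuation_ring_def)
  then show ?thesis by blast
qed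

end

section \<open>Real closed fields\<close>

context valuation_subring
begin

definition R :: "'a ring" where
  "R = ring_of_type_algebra\<lparr>carrier := A\<rparr>"

lemma R_simps [simp]:
  "carrier R = A" "x \<otimes>\<^bsub>R\<^esub> y = x * y" "x \<oplus>\<^bsub>R\<^esub> y = x + y" "\<one>\<^bsub>R\<^esub> = 1" "\<zero>\<^bsub>R\<^esub> = 0"
  by (simp_all add: R_def ring_of_type_algebra_def)

lemma R_cring: "cring R"
proof (rule cringI)
  show "abelian_group R"
  proof (rule abelian_groupI)
    fix x assume "x \<in> carrier R"
    then show "\<exists>y\<in>carrier R. y \<oplus>\<^bsub>R\<^esub> x = \<zero>\<^bsub>R\<^esub>"
      by (intro bexI[of _ "- x"]) (auto intro: uminus_closed)
  qed (auto simp: add_closed zero_mem add_ac)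
  show "Group.comm_monoid R"
    by (rule comm_monoidI) (auto simp: mult_closed one_mem mult_ac)
qed (auto simp: distrib_right)

text \<open>This links evaluation of coefficient lists with \<open>poly\<close>. The reversal is due
  to \<open>Poly\<close> expecting the constant coefficient first.\<close>

lemma eval_hom:
  assumes "ring Q" "h \<in> ring_hom R Q" "a \<in> A" "set xs \<subseteq> A"
  shows "ring.eval Q (map h xs) (h a) = h (poly (Poly (rev xs)) a)"
proof -
  interpret R: cring R by (rule R_cring)
  interpret Q: ring Q by fact
  have pow: "h a [^]\<^bsub>Q\<^esub> k = h (a ^ k)" for k :: nat
  proof (induction k)
    case 0
    then show ?case using ring_hom_one[OF assms(2)] by simp
  next
    case (Suc k)
    then show ?case
      using ring_hom_mult[OF assms(2), of "a ^ k" a] assms(3) power_closed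
      by (simp add: mult.commute)
  qed
  have PA: "Poly (rev xs) \<in> PA" if "set xs \<subseteq> A" for xs
    using that by (induction xs) (auto simp: Poly_snoc intro!: PA_add PA_monom)
  show ?thesis
    using assms(4)
  proof (induction xs)
    case Nil
    then show ?case
      using ring_hom_zero[OF assms(2) R.ring_axioms Q.ring_axioms] by simp
  next
    case (Cons x xs)
    have "h x \<otimes>\<^bsub>Q\<^esub> h (a ^ length xs) = h (x * a ^ length xs)"
      using ring_hom_mult[OF assms(2), of x "a ^ length xs"] Cons.prems assms(3) power_closed by simp
    moreover have "h (x * a ^ length xs) \<oplus>\<^bsub>Q\<^esub> h (poly (Poly (rev xs)) a)
        = h (x * a ^ length xs + poly (Poly (rev xs)) a)"
      using ring_hom_add[OF assms(2), of "x * a ^ length xs" "poly (Poly (rev xs)) a"]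
        Cons.prems assms(3) by (simp add: mult_closed power_closed PA PA_poly)
    ultimately show ?case
      using Cons by (simp add: pow Poly_snoc poly_monom add.commute)
  qed
qed

lemma M_ideal: "ideal M R"
proof (rule idealI)
  show "ring R"
    using R_cring by (rule cring.axioms)
  then interpret R: ring R .
  show "subgroup M (add_monoid R)"
  proof
    show "inv\<^bsub>add_monoid R\<^esub> x \<in> M" if "x \<in> M" for x
    proof -
      have "\<ominus>\<^bsub>R\<^esub> x = - x"
        using that M_subset uminus_closed by (intro R.minus_equality) auto
      then show ?thesis
        using that M_uminus by (simp add: a_inv_def)
    qed
  qed (auto simp: M_subset M_add zero_in_M)
qed (auto simp: M_mult M_mult')

end

text \<open>The order of the residue field is pulled back to a preordering of \<open>A\<close>,
  where the axioms of \<open>real_closed_residue\<close> are checked.\<close>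

lemma (in henselian_subring) real_closed_residueI:
  assumes "real_closed (R Quot M)"
  shows "real_closed_residue A"
proof -
  interpret M: ideal M R by (rule M_ideal)
  define Q where "Q = R Quot M"
  define h where "h = (+>\<^bsub>R\<^esub>) M"
  obtain le where le: "ordered_field Q le \<and>
    (\<forall>x. (\<zero>\<^bsub>Q\<^esub>, x) \<in> le \<longrightarrow> (\<exists>y\<in>carrier Q. x = y \<otimes>\<^bsub>Q\<^esub> y)) \<and>
    (\<forall>p\<in>carrier (poly_ring Q). odd (Polynomials.degree p) \<longrightarrow>
      (\<exists>x\<in>carrier Q. ring.eval Q p x = \<zero>\<^bsub>Q\<^esub>))"
    using assms[folded Q_def] unfolding real_closed_def ..
  interpret Q: ordered_field Q le
    using le by (rule conjunct1)
  note le_square = le[THEN conjunct2, THEN conjunct1, rule_format]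
    and odd_root = le[THEN conjunct2, THEN conjunct2, rule_format]
  have h: "h \<in> ring_hom R Q"
    unfolding h_def Q_def by (rule M.rcos_ring_hom)
  have h_mult: "h (x * y) = h x \<otimes>\<^bsub>Q\<^esub> h y" and h_add: "h (x + y) = h x \<oplus>\<^bsub>Q\<^esub> h y"
    if "x \<in> A" "y \<in> A" for x y
    using that ring_hom_mult[OF h] ring_hom_add[OF h] by simp_all
  have h_1: "h 1 = \<one>\<^bsub>Q\<^esub>"
    using ring_hom_one[OF h] by simp
  have h_0: "h 0 = \<zero>\<^bsub>Q\<^esub>"
    using ring_hom_zero[OF h M.ring_axioms Q.ring_axioms] by simp
  have carrier_Q: "carrier Q = h ` A"
    by (auto simp: Q_def h_def FactRing_def A_RCOSETS_def' a_r_coset_def RCOSETS_def)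
  have h_carrier: "h x \<in> carrier Q" if "x \<in> A" for x
    using that carrier_Q by blast
  have h_zero_iff: "h x = \<zero>\<^bsub>Q\<^esub> \<longleftrightarrow> x \<in> M" if "x \<in> A" for x
    using that M.rcos_const_imp_mem[of x] M.a_rcos_const[of x] by (auto simp: Q_def h_def FactRing_def)
  have h_uminus: "h (- x) = \<ominus>\<^bsub>Q\<^esub> h x" if "x \<in> A" for x
    using that h_add[of "- x" x] h_0 h_carrier uminus_closed
    by (intro Q.minus_equality[symmetric]) simp_all
  \<comment> \<open>The elements with non-negative residue; \<open>P\<close> and its negative meet
    exactly in \<open>M\<close>.\<close>
  define P where "P = {x \<in> A. (\<zero>\<^bsub>Q\<^esub>, h x) \<in> le}"
  have le_Field: "x \<in> carrier Q" "y \<in> carrier Q" if "(x, y) \<in> le" for x y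
    using that Q.le_linear
    unfolding linear_order_on_def partial_order_on_def preorder_on_def refl_on_def by auto
  have le_total: "(x, y) \<in> le \<or> (y, x) \<in> le" if "x \<in> carrier Q" "y \<in> carrier Q" for x y
    using that Q.le_linear
    unfolding linear_order_on_def partial_order_on_def preorder_on_def refl_on_def total_on_def
    by (cases "x = y") auto
  have le_trans: "(x, z) \<in> le" if "(x, y) \<in> le" "(y, z) \<in> le" for x y z
    using that Q.le_linear
    unfolding linear_order_on_def partial_order_on_def preorder_on_def by (auto dest: transD)
  have le_antisym: "x = y" if "(x, y) \<in> le" "(y, x) \<in> le" for x y
    using that Q.le_linear
    unfolding linear_order_on_def partial_order_on_def by (auto dest: antisymD)
  have P_total: "x \<in> P \<or> - x \<in> P" if "x \<in> A" for x
  proof (cases "(\<zero>\<^bsub>Q\<^esub>, h x) \<in> le")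
    case False
    then have "(h x, \<zero>\<^bsub>Q\<^esub>) \<in> le"
      using le_total that h_carrier by blast
    then have "(h x \<oplus>\<^bsub>Q\<^esub> h (- x), \<zero>\<^bsub>Q\<^esub> \<oplus>\<^bsub>Q\<^esub> h (- x)) \<in> le"
      using that uminus_closed h_carrier by (intro Q.le_add) auto
    then have "(\<zero>\<^bsub>Q\<^esub>, h (- x)) \<in> le"
      using that uminus_closed h_carrier h_add[of x "- x"] h_0 by simp
    then show ?thesis
      using that uminus_closed by (simp add: P_def)
  qed (use that in \<open>simp add: P_def\<close>)
  have P_mult: "x * y \<in> P" if "x \<in> P" "y \<in> P" for x y
    using that Q.le_mult by (auto simp: P_def mult_closed h_mult)
  have P_add: "x + y \<in> P" if "x \<in> P" "y \<in> P" for x y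
  proof -
    have "(\<zero>\<^bsub>Q\<^esub> \<oplus>\<^bsub>Q\<^esub> h y, h x \<oplus>\<^bsub>Q\<^esub> h y) \<in> le"
      using that h_carrier by (intro Q.le_add) (auto simp: P_def)
    then have "(h y, h (x + y)) \<in> le"
      using that h_carrier by (simp add: P_def h_add)
    then show ?thesis
      using that le_trans add_closed by (auto simp: P_def)
  qed
  have P_square: "x * x \<in> P" if "x \<in> A" for x
    using P_total[OF that] P_mult[of x x] P_mult[of "- x" "- x"] by auto
  have P_M: "x \<in> M" if "x \<in> P" "- x \<in> P" for x
  proof -
    have "(\<zero>\<^bsub>Q\<^esub> \<oplus>\<^bsub>Q\<^esub> h x, h (- x) \<oplus>\<^bsub>Q\<^esub> h x) \<in> le"
      using that h_carrier by (intro Q.le_add) (auto simp: P_def)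
    moreover have "h (- x) \<oplus>\<^bsub>Q\<^esub> h x = \<zero>\<^bsub>Q\<^esub>"
      using that h_0 by (simp add: P_def flip: h_add)
    ultimately have "(h x, \<zero>\<^bsub>Q\<^esub>) \<in> le"
      using that h_carrier by (simp add: P_def)
    then show ?thesis
      using that le_antisym[of "h x"] h_zero_iff[of x] by (auto simp: P_def)
  qed
  have P_one: "1 \<in> P"
    using P_square[OF one_mem] by simp
  have M_P: "x \<in> P" if "x \<in> M" for x
    using that M_subset h_zero_iff[of x] le_total[of "\<zero>\<^bsub>Q\<^esub>" "\<zero>\<^bsub>Q\<^esub>"] by (auto simp: P_def)
  \<comment> \<open>Otherwise \<open>- (1 + x)\<close> lies in \<open>P\<close>, and adding
    \<open>x\<close> puts \<open>- 1\<close> into \<open>P\<close>, hence 1 into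
    \<open>M\<close>.\<close>
  have one_add_P: "1 + x \<notin> M" if "x \<in> P" for x
  proof
    assume "1 + x \<in> M"
    then have "- (1 + x) \<in> P"
      using M_P M_uminus by blast
    then have "- (1 + x) + x \<in> P"
      using that P_add by blast
    then show False
      using P_M[of 1] P_one one_notin_M by simp
  qed
  have P_sqrt: "\<exists>y\<in>A. x - y * y \<in> M" if x: "x \<in> P" for x
  proof -
    obtain y where y: "y \<in> A" "h x = h y \<otimes>\<^bsub>Q\<^esub> h y"
      using x le_square[of "h x"] carrier_Q by (auto simp: P_def)
    have "h (x - y * y) = h x \<oplus>\<^bsub>Q\<^esub> \<ominus>\<^bsub>Q\<^esub> h (y * y)"
      using h_add[of x "- (y * y)"] x y(1) by (simp add: P_def h_uminus mult_closed uminus_closed)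
    also have "\<dots> = \<zero>\<^bsub>Q\<^esub>"
      using y h_carrier by (simp add: h_mult Q.r_neg)
    finally have "h (x - y * y) = \<zero>\<^bsub>Q\<^esub>" .
    then show ?thesis
      using x y h_zero_iff[of "x - y * y"] by (auto simp: P_def mult_closed diff_closed)
  qed
  show ?thesis
  proof
    show "\<exists>y\<in>A. x - y * y \<in> M \<or> x + y * y \<in> M" if "x \<in> A" for x
      using P_total[OF that]
    proof
      assume "- x \<in> P"
      then obtain y where "y \<in> A" "- x - y * y \<in> M"
        using P_sqrt by blast
      then show ?thesis
        using M_uminus[of "- x - y * y"] by (intro bexI[of _ y]) (simp_all add: add.commute)
    qed (use P_sqrt in blast)
    show "1 + x * x + y * y \<notin> M" if "x \<in> A" "y \<in> A" for x y
      using one_add_P[of "x * x + y * y"] P_add P_square that by (simp add: add.assoc)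
    show "of_nat (Suc n) \<notin> M" for n
    proof -
      have "of_nat n \<in> P"
        by (induction n) (auto intro: P_add P_one M_P zero_in_M)
      then show ?thesis
        using one_add_P by simp
    qed
    show "\<exists>a\<in>A. poly p a \<in> M"
      if p: "p \<in> PA" "lead_coeff p = 1" "odd (Polynomial.degree p)" for p
    proof -
      have "p \<noteq> 0" using p(3) by auto
      \<comment> \<open>The reduction of \<open>p\<close> as a coefficient list. Its head is the
        residue of 1, hence non-zero as required of a record polynomial.\<close>
      define q where "q = map h (rev (coeffs p))"
      have cA: "set (coeffs p) \<subseteq> A"
        using p(1) by (auto simp: PA_def coeffs_def)
      have "coeffs p \<noteq> []"
        using \<open>p \<noteq> 0\<close> by simp
      then have "hd q = \<one>\<^bsub>Q\<^esub>"
        using p(2) by (simp add: q_def hd_map hd_rev last_coeffs_eq_coeff_degree \<open>p \<noteq> 0\<close> h_1)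
      moreover have "set q \<subseteq> carrier Q"
        using cA h_carrier by (auto simp: q_def)
      ultimately have "q \<in> carrier (poly_ring Q)"
        by (simp add: univ_poly_def polynomial_def)
      moreover have "Polynomials.degree q = Polynomial.degree p"
        by (simp add: q_def degree_eq_length_coeffs)
      ultimately obtain a where a: "a \<in> A" "ring.eval Q q (h a) = \<zero>\<^bsub>Q\<^esub>"
        using odd_root[of q] p(3) carrier_Q by auto
      have "ring.eval Q q (h a) = h (poly p a)"
        unfolding q_def using eval_hom[OF Q.ring_axioms h a(1), of "rev (coeffs p)"] cA by simp
      then show ?thesis
        using a h_zero_iff PA_poly[OF p(1)] by metis
    qed
  qed
qed

text \<open>Divisibility by 2 makes every element a signed square. Sums of squares are squares by
  the residue condition, so the squares form a positive cone; odd degrees are covered by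
  \<open>odd_degree_root\<close>.\<close>

lemma (in real_closed_residue) real_closed_if_divisible:
  assumes divisible: "\<And>(x :: 'a) n. \<lbrakk>x \<noteq> 0; n > 0\<rbrakk> \<Longrightarrow> \<exists>y. x = y ^ n \<or> x = - (y ^ n)"
  shows "real_closed (ring_of_type_algebra :: 'a ring)"
proof -
  let ?K = "ring_of_type_algebra :: 'a ring"
  have K [simp]: "carrier ?K = UNIV" "x \<otimes>\<^bsub>?K\<^esub> y = x * y" "x \<oplus>\<^bsub>?K\<^esub> y = x + y" "\<zero>\<^bsub>?K\<^esub> = 0" for x y
    by (simp_all add: ring_of_type_algebra_def)
  have sqrt: "\<exists>y. x = y * y \<or> x = - (y * y)" for x :: 'a
    using divisible[of x 2] by (cases "x = 0") (auto simp: power2_eq_square intro: exI[of _ 0])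
  have sum_eq_0: "x = 0" if "x * x + y * y = 0" for x y :: 'a
  proof (rule ccontr)
    have *: "False" if "x * x + y * y = 0" "x \<noteq> 0" "y / x \<in> A" for x y :: 'a
    proof -
      have "1 + y / x * (y / x) = (x * x + y * y) / (x * x)"
        using that by (simp add: field_simps)
      then show False
        using residue_sum_squares[of "y / x" 0] that zero_mem zero_in_M by simp
    qed
    assume "x \<noteq> 0"
    then have "y \<noteq> 0"
      using that by auto
    have "y / x \<in> A \<or> x / y \<in> A"
      using total[of "y / x"] by simp
    then show False
      using *[of x y] *[of y x] that \<open>x \<noteq> 0\<close> \<open>y \<noteq> 0\<close> by (auto simp: add.commute)
  qed
  have sum: "\<exists>z. x * x + y * y = z * z" for x y :: 'a
  proof -
    have *: "\<exists>z. x * x + y * y = z * z" if "x \<noteq> 0" "y / x \<in> A" for x y :: 'a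
    proof -
      define t where "t = y / x"
      have y: "y = x * t"
        using that by (simp add: t_def)
      have tA: "t \<in> A"
        using that by (simp add: t_def)
      obtain w where w: "1 + t * t = w * w \<or> 1 + t * t = - (w * w)"
        using sqrt by blast
      \<comment> \<open>Equality would put \<open>w ^ 2\<close>, hence \<open>w\<close>, into
        \<open>A\<close>, and \<open>1 + t * t + w * w = 0\<close> contradicts
        \<open>residue_sum_squares\<close>.\<close>
      have "1 + t * t \<noteq> - (w * w)"
      proof
        assume eq: "1 + t * t = - (w * w)"
        then have "w ^ 2 = - (1 + t * t)"
          by (simp add: power2_eq_square)
        then have "w ^ 2 \<in> A"
          using tA by (metis uminus_closed add_closed one_mem mult_closed)
        then have "w \<in> A"
          by (rule A_powerD) simp
        moreover have "1 + t * t + w * w = 0"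
          using eq by simp
        ultimately show False
          using residue_sum_squares[OF tA] zero_in_M by metis
      qed
      moreover have "x * x + y * y = x * x * (1 + t * t)"
        unfolding y by (simp add: algebra_simps)
      ultimately have "x * x + y * y = x * w * (x * w)"
        using w by (simp add: mult_ac)
      then show ?thesis ..
    qed
    show ?thesis
    proof (cases "x = 0 \<or> y = 0")
      case False
      then have "y / x \<in> A \<or> x / y \<in> A"
        using total[of "y / x"] by simp
      then show ?thesis
        using *[of x y] *[of y x] False by (auto simp: add.commute)
    qed auto
  qed
  define le where "le = {(x :: 'a, y). \<exists>z. y - x = z * z}"
  have "ordered_field ?K le"
  proof (intro ordered_field.intro ordered_field_axioms.intro)
    show "field ?K" ..
    show "linear_order_on (carrier ?K) le"
      unfolding linear_order_on_def partial_order_on_def preorder_on_def refl_on_def total_on_def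
    proof (intro conjI ballI impI)
      show "(x, x) \<in> le" for x
        by (auto simp: le_def intro: exI[of _ 0])
      show "trans le"
      proof (rule transI)
        fix x y z assume "(x, y) \<in> le" "(y, z) \<in> le"
        then obtain a b where "y - x = a * a" "z - y = b * b"
          by (auto simp: le_def)
        moreover obtain c where "a * a + b * b = c * c"
          using sum by blast
        ultimately have "z - x = c * c"
          by (metis add.commute diff_add_cancel add_diff_eq)
        then show "(x, z) \<in> le"
          by (auto simp: le_def)
      qed
      show "antisym le"
      proof (rule antisymI)
        fix x y assume "(x, y) \<in> le" "(y, x) \<in> le"
        then obtain a b where a: "y - x = a * a" and b: "x - y = b * b"
          by (auto simp: le_def)
        have "a * a + b * b = 0"
          by (simp flip: a b)
        then have "a = 0"
          by (rule sum_eq_0)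
        then show "x = y"
          using a by simp
      qed
      show "(x, y) \<in> le \<or> (y, x) \<in> le" for x y
        using sqrt[of "y - x"] by (auto simp: le_def) (metis minus_diff_eq minus_minus)
    qed simp
    show "(x \<oplus>\<^bsub>?K\<^esub> z, y \<oplus>\<^bsub>?K\<^esub> z) \<in> le" if "(x, y) \<in> le" for x y z
      using that by (simp add: le_def)
    show "(\<zero>\<^bsub>?K\<^esub>, x \<otimes>\<^bsub>?K\<^esub> y) \<in> le" if xy: "(\<zero>\<^bsub>?K\<^esub>, x) \<in> le" "(\<zero>\<^bsub>?K\<^esub>, y) \<in> le" for x y
    proof -
      obtain a b where "x = a * a" "y = b * b"
        using xy by (auto simp: le_def)
      then show ?thesis
        by (auto simp: le_def mult_ac intro!: exI[of _ "a * b"])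
    qed
  qed
  moreover have "\<exists>y\<in>carrier ?K. x = y \<otimes>\<^bsub>?K\<^esub> y" if "(\<zero>\<^bsub>?K\<^esub>, x) \<in> le" for x
    using that by (auto simp: le_def)
  moreover have "\<exists>x\<in>carrier ?K. ring.eval ?K p x = \<zero>\<^bsub>?K\<^esub>"
    if p: "p \<in> carrier (poly_ring ?K)" "odd (Polynomials.degree p)" for p
  proof -
    \<comment> \<open>With the trivial valuation ring and the identity map, \<open>eval_hom\<close>
      translates evaluation over \<open>K\<close> itself.\<close>
    interpret U: valuation_subring "UNIV :: 'a set"
      by unfold_locales auto
    have "U.R = ?K"
      by (simp add: U.R_def ring_of_type_algebra_def)
    then have eval: "ring.eval ?K p x = poly (Poly (rev p)) x" for x
      using U.eval_hom[of ?K id x p] ring_from_type_algebra by (simp add: ring_hom_def)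
    have "p \<noteq> []"
      using p(2) by auto
    then have hd: "hd p \<noteq> 0"
      using p(1) by (simp add: univ_poly_def polynomial_def)
    have "Polynomial.degree (Poly (rev p)) = Polynomials.degree p"
    proof (intro antisym degree_le le_degree)
      show "Polynomial.coeff (Poly (rev p)) (Polynomials.degree p) \<noteq> 0"
        using hd \<open>p \<noteq> []\<close> by (simp add: nth_default_def rev_nth hd_conv_nth)
      show "\<forall>i>Polynomials.degree p. Polynomial.coeff (Poly (rev p)) i = 0"
        by (auto simp: nth_default_def)
    qed
    then show ?thesis
      using odd_degree_root[OF divisible] p(2) eval by (metis K(1,4) UNIV_I)
  qed
  ultimately show ?thesis
    unfolding real_closed_def by blast
qed

theorem corollary3p11:
  fixes G :: "'g ordered_group" and v :: "'k::field \<Rightarrow> 'g"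
  assumes not_real_closed: "\<not> real_closed (ring_of_type_algebra :: 'k ring)"
    and valuation: "valuation G v"
    and henselian: "henselian G v"
    and residue_real_closed: "real_closed (residue_field G v)"
  shows "\<exists>(H :: 'k set ordered_group) (w :: 'k \<Rightarrow> 'k set).
           valuation H w \<and> nontrivial_valuation H w \<and> henselian H w \<and>
           zero_definable_valuation H w"
proof -
  interpret valuation G v by fact
  let ?A = "valuation_ring G v"
  interpret henselian_subring ?A
    using henselian
    by unfold_locales (auto simp: henselian_def valuation_ideal_eq_M PA_def)
  interpret real_closed_residue ?A
    using residue_real_closed
    by (intro real_closed_residueI) (simp add: residue_field_def R_def valuation_ideal_eq_M)
  \<comment> \<open>As \<open>K\<close> is not real closed, divisibility fails; the exponent found
    here determines \<open>T\<close>, and \<open>x\<close> shows that \<open>T\<close> is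
    proper.\<close>
  obtain x :: 'k and n where n: "n > 0" "x \<noteq> 0" "\<nexists>y. x = y ^ n \<or> x = - (y ^ n)"
    using real_closed_if_divisible not_real_closed by blast
  then have x: "x \<notin> signed_powers n"
    unfolding signed_powers_def by blast
  have "units_in_subgroup ?A (signed_powers n)"
  proof (intro units_in_subgroup.intro units_in_subgroup_axioms.intro)
    show "valuation_subring ?A"
      by (rule valuation_subring)
    show "\<exists>x :: 'k. x \<noteq> 0 \<and> x \<notin> signed_powers n"
      using n(2) x by (intro exI[of _ x] conjI)
    show "(0 :: 'k) \<notin> signed_powers n"
      using signed_powers_nonzero by blast
    show "x \<in> signed_powers n" if "x \<in> ?A" "x \<notin> M" for x
      using units_subset_signed_powers that n(1) .
  qed (rule signed_powers_mult signed_powers_inverse; assumption)+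
  then interpret T: units_in_subgroup ?A "signed_powers n" .
  interpret B: henselian_subring T.B
    using T.B_valuation_subring T.A_subset_B by (rule henselian_overring)
  have "zero_definable_valuation B.coset_group B.unit_coset"
    unfolding zero_definable_valuation_def B.coset_valuation_ring
    unfolding T.B_eq
    by (rule zero_definable_signed_powers_formula)
  then show ?thesis
    using B.coset_valuation B.coset_valuation_nontrivial[OF T.B_proper] B.coset_valuation_henselian
    by blast
qed

end
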